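(* Let $G$ be a group, $k$ a unital commutative ring, $n$ a positive integer, and let $R=(M_{ij})_{i,j\in\mathbb{I}_n}$ be an $n$-by-$n$ generalized matrix ring such that each $R_i=M_{ii}$ is a unital ring. Let $\mathcal{D}=\big(\{\alpha^{(i)}\}_{i\in\mathbb{I}_n},\{\gamma_g\}_{g\in G}\big)$ be a datum for $R$ and let $i,j\in\mathbb{I}_n$. Assume that $R_i$ and $R_j$ are $k$-algebras, that $M_{ij}M_{ji}=R_i$ and $M_{ji}M_{ij}=R_j$, and that the partial actions $\alpha^{(i)}$ and $\alpha^{(j)}$ are regular. Then $\alpha^{(i)}$ and $\alpha^{(j)}$ are Morita equivalent.
   Context: Rings are associative; modules over unital rings are unital. $\mathbb{I}_n=\{1,\dots,n\}$. An $n$-by-$n$ generalized matrix ring $R=(M_{ij})_{i,j\in\mathbb{I}_n}$ is given by rings $R_1,\dots,R_n$, $(R_i,R_j)$-bimodules $M_{ij}$ with $M_{ii}=R_i$, and bimodule morphisms $\theta_{ijk}:M_{ij}\otimes_{R_j}M_{jk}\to M_{ik}$; one writes $m_{ij}m_{jk}:=\theta_{ijk}(m_{ij}\otimes m_{jk})$ and requires $(m_{ij}m_{jk})m_{kl}=m_{ij}(m_{jk}m_{kl})$ for all indices. Here $\theta_{iii}$ is the multiplication of $R_i$, and $\theta_{ijj},\theta_{jjk}$ are given by the bimodule structures. Elements of $R$ are arrays $(m_{ij})$, $m_{ij}\in M_{ij}$, with componentwise addition and row-column multiplication. Products such as $DM$ or $M_{ij}M_{ji}$ denote the additive subgroup generated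 by all products. A partial action of a group $G$ (identity $e$) on a ring $A$ is a family $\alpha=(A_g,\alpha_g)_{g\in G}$ where each $A_g$ is an ideal of $A$ and $\alpha_g:A_{g^{-1}}\to A_g$ is a ring isomorphism, such that (i) $A_e=A$, $\alpha_e=\mathrm{id}_A$; (ii) $\alpha_{h^{-1}}(A_h\cap A_{g^{-1}})\subset A_{(gh)^{-1}}$ for all $g,h\in G$; (iii) $\alpha_g(\alpha_h(a))=\alpha_{gh}(a)$ for all $a\in\alpha_h^{-1}(A_h\cap A_{g^{-1}})$. For a partial action on a $k$-algebra the $\alpha_g$ are $k$-algebra isomorphisms. It is regular if $A_{g_1}\cap\dots\cap A_{g_m}=A_{g_1}\cdots A_{g_m}$ for all $m>0$ and $g_1,\dots,g_m\in G$. A product partial action of $G$ on $A$ is a family $(A_g,\alpha_g)_{g\in G}$ of ideals $A_g$ and ring isomorphisms $\alpha_g:A_{g^{-1}}\to A_g$ with $A_e=A$, $\alpha_e=\mathrm{id}_A$; $A_g^2=A_g$, $A_gA_h=A_hA_g$; $\alpha_g(A_{g^{-1}}A_h)=A_gA_{gh}$; and $\alpha_g(\alpha_h(a))=\alpha_{gh}(a)$ for all $a\in A_{h^{-1}}A_{(gh)^{-1}}$ ($g,h\in G$). Datum: $\mathcal{D}=\big(\{\alpha^{(i)}\}_{i\in\mathbb{I}_n},\{\gamma_g\}_{g\in G}\big)$, with $\alpha^{(i)}=(D^{(i)}_g,\alpha^{(i)}_g)_{g\in G}$ a partial action of $G$ on $R_i$ and $\gamma_g=\{\gamma^{(ij)}_g:D^{(i)}_{g^{-1}}M_{ij}\to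 D^{(i)}_gM_{ij}\}_{i,j\in\mathbb{I}_n}$ a set of additive bijections, is a datum for $R$ if: (a) $D^{(i)}_gM_{ij}=M_{ij}D^{(j)}_g$ for all $g\in G$, $i,j\in\mathbb{I}_n$; (b) for all $g,h\in G$ and $i,j,k\in\mathbb{I}_n$: $\gamma^{(ii)}_g=\alpha^{(i)}_g$ and $\gamma^{(ij)}_e=\mathrm{id}_{M_{ij}}$; $\gamma^{(ik)}_g(u)\gamma^{(kj)}_g(v)=\gamma^{(ij)}_g(uv)$ for all $u\in D^{(i)}_{g^{-1}}M_{ik}$, $v\in D^{(k)}_{g^{-1}}M_{kj}$; $(\gamma^{(ij)}_h)^{-1}\big(D^{(i)}_{g^{-1}}M_{ij}\cap D^{(i)}_hM_{ij}\big)\subset D^{(i)}_{(gh)^{-1}}M_{ij}$; and $\gamma^{(ij)}_g(\gamma^{(ij)}_h(a))=\gamma^{(ij)}_{gh}(a)$ for all $a\in(\gamma^{(ij)}_h)^{-1}\big(D^{(i)}_{g^{-1}}M_{ij}\cap D^{(i)}_hM_{ij}\big)$. Morita equivalence: regular partial actions $\alpha=(D_g,\alpha_g)_{g\in G}$ and $\alpha'=(D'_g,\alpha'_g)_{g\in G}$ of $G$ on $k$-algebras $A$ and $A'$ are Morita equivalent if (i) there is a Morita context $(A,A',M,M',\tau,\tau')$ with $\tau:M\otimes_{A'}M'\to A$ and $\tau':M'\otimes_AM\to A'$ surjective, $M,M'$ unital bimodules, and $M'D_gM=D'_g$ for all $g\in G$; and (ii) there is a product partial action $\theta$ of $G$ on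 the Morita ring $\begin{pmatrix} A & M \\ M' & A' \end{pmatrix}$ whose restriction to $\begin{pmatrix} A & 0 \\ 0 & 0 \end{pmatrix}$ is $\alpha$ and whose restriction to $\begin{pmatrix} 0 & 0 \\ 0 & A' \end{pmatrix}$ is $\alpha'$. *)

theory Defs
  imports
    "HOL-Algebra.Free_Abelian_Groups"
    "HOL-Algebra.Ideal_Product"
    "HOL-Algebra.Module"
begin

section \<open>Bimodules and tensor products\<close>

text \<open>As for the library record \<^typ>\<open>('k, 'a) module\<close>, the fields for multiplication and unit that are
  inherited from \<^typ>\<open>'m ring\<close> are ignored for a mere bimodule.  They are used for the diagonal
  entries of a generalized matrix ring, which are rings and bimodules over themselves.\<close>

record ('r, 's, 'm) bimod = "'m ring" +
  lact :: "'r \<Rightarrow> 'm \<Rightarrow> 'm"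
  ract :: "'m \<Rightarrow> 's \<Rightarrow> 'm"

locale unital_bimodule = R: ring R + S: ring S + M: abelian_group M
  for R :: "('r, 'x) ring_scheme" and S :: "('s, 'y) ring_scheme"
    and M :: "('r, 's, 'm, 'z) bimod_scheme" +
  assumes lact_closed: "\<lbrakk>r \<in> carrier R; m \<in> carrier M\<rbrakk> \<Longrightarrow> lact M r m \<in> carrier M"
    and lact_add_left: "\<lbrakk>r \<in> carrier R; r' \<in> carrier R; m \<in> carrier M\<rbrakk>
      \<Longrightarrow> lact M (r \<oplus>\<^bsub>R\<^esub> r') m = lact M r m \<oplus>\<^bsub>M\<^esub> lact M r' m"
    and lact_add_right: "\<lbrakk>r \<in> carrier R; m \<in> carrier M; m' \<in> carrier M\<rbrakk>
      \<Longrightarrow> lact M r (m \<oplus>\<^bsub>M\<^esub> m') = lact M r m \<oplus>\<^bsub>M\<^esub> lact M r m'"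
    and lact_mult: "\<lbrakk>r \<in> carrier R; r' \<in> carrier R; m \<in> carrier M\<rbrakk>
      \<Longrightarrow> lact M (r \<otimes>\<^bsub>R\<^esub> r') m = lact M r (lact M r' m)"
    and lact_one: "m \<in> carrier M \<Longrightarrow> lact M \<one>\<^bsub>R\<^esub> m = m"
    and ract_closed: "\<lbrakk>m \<in> carrier M; s \<in> carrier S\<rbrakk> \<Longrightarrow> ract M m s \<in> carrier M"
    and ract_add_left: "\<lbrakk>m \<in> carrier M; m' \<in> carrier M; s \<in> carrier S\<rbrakk>
      \<Longrightarrow> ract M (m \<oplus>\<^bsub>M\<^esub> m') s = ract M m s \<oplus>\<^bsub>M\<^esub> ract M m' s"
    and ract_add_right: "\<lbrakk>m \<in> carrier M; s \<in> carrier S; s' \<in> carrier S\<rbrakk>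
      \<Longrightarrow> ract M m (s \<oplus>\<^bsub>S\<^esub> s') = ract M m s \<oplus>\<^bsub>M\<^esub> ract M m s'"
    and ract_mult: "\<lbrakk>m \<in> carrier M; s \<in> carrier S; s' \<in> carrier S\<rbrakk>
      \<Longrightarrow> ract M m (s \<otimes>\<^bsub>S\<^esub> s') = ract M (ract M m s) s'"
    and ract_one: "m \<in> carrier M \<Longrightarrow> ract M m \<one>\<^bsub>S\<^esub> = m"
    and lact_ract: "\<lbrakk>r \<in> carrier R; m \<in> carrier M; s \<in> carrier S\<rbrakk>
      \<Longrightarrow> ract M (lact M r m) s = lact M r (ract M m s)"

definition ring_bimod :: "('a, 'x) ring_scheme \<Rightarrow> ('a, 'a, 'a) bimod" where
  "ring_bimod A = \<lparr>carrier = carrier A, mult = mult A, one = one A, zero = zero A, add = add A,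
     lact = mult A, ract = mult A\<rparr>"

definition tensor_relations ::
  "('s, 'x) ring_scheme \<Rightarrow> ('r, 's, 'm, 'y) bimod_scheme \<Rightarrow> ('s, 't, 'n, 'z) bimod_scheme
    \<Rightarrow> (('m \<times> 'n) \<Rightarrow>\<^sub>0 int) set" where
  "tensor_relations S M N =
     {frag_of (m \<oplus>\<^bsub>M\<^esub> m', x) - frag_of (m, x) - frag_of (m', x) | m m' x.
        m \<in> carrier M \<and> m' \<in> carrier M \<and> x \<in> carrier N} \<union>
     {frag_of (m, x \<oplus>\<^bsub>N\<^esub> x') - frag_of (m, x) - frag_of (m, x') | m x x'.
        m \<in> carrier M \<and> x \<in> carrier N \<and> x' \<in> carrier N} \<union>
     {frag_of (ract M m s, x) - frag_of (m, lact N s x) | m s x.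
        m \<in> carrier M \<and> s \<in> carrier S \<and> x \<in> carrier N}"

text \<open>The additive group of the tensor product of \<open>M\<close> and \<open>N\<close> over \<open>S\<close>, written multiplicatively
  as in the library theory of free abelian groups.\<close>

definition tensor_product ::
  "('s, 'x) ring_scheme \<Rightarrow> ('r, 's, 'm, 'y) bimod_scheme \<Rightarrow> ('s, 't, 'n, 'z) bimod_scheme
    \<Rightarrow> (('m \<times> 'n) \<Rightarrow>\<^sub>0 int) set monoid" where
  "tensor_product S M N =
     (let F = free_Abelian_group (carrier M \<times> carrier N)
      in F Mod generate F (tensor_relations S M N))"

definition pure_tensor ::
  "('s, 'x) ring_scheme \<Rightarrow> ('r, 's, 'm, 'y) bimod_scheme \<Rightarrow> ('s, 't, 'n, 'z) bimod_scheme
    \<Rightarrow> 'm \<Rightarrow> 'n \<Rightarrow> (('m \<times> 'n) \<Rightarrow>\<^sub>0 int) set" where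
  "pure_tensor S M N m x =
     (let F = free_Abelian_group (carrier M \<times> carrier N)
      in generate F (tensor_relations S M N) #>\<^bsub>F\<^esub> frag_of (m, x))"

text \<open>\<open>(R,T)\<close>-bimodule morphisms from the tensor product over \<open>S\<close> of an \<open>(R,S)\<close>-bimodule \<open>M\<close> and an
  \<open>(S,T)\<close>-bimodule \<open>N\<close> to an \<open>(R,T)\<close>-bimodule \<open>P\<close>.  The actions on the tensor product are
  determined by \<open>r (m \<otimes> x) = (r m) \<otimes> x\<close> and \<open>(m \<otimes> x) t = m \<otimes> (x t)\<close>, and the pure tensors generate
  it, so an additive map is a bimodule morphism iff it respects the actions on pure tensors.\<close>

definition tensor_bimodule_hom where
  "tensor_bimodule_hom R S T M N P f \<longleftrightarrow>
     f \<in> hom (tensor_product S M N) (add_monoid P) \<and>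
     (\<forall>r \<in> carrier R. \<forall>m \<in> carrier M. \<forall>x \<in> carrier N.
        f (pure_tensor S M N (lact M r m) x) = lact P r (f (pure_tensor S M N m x))) \<and>
     (\<forall>m \<in> carrier M. \<forall>x \<in> carrier N. \<forall>t \<in> carrier T.
        f (pure_tensor S M N m (ract N x t)) = ract P (f (pure_tensor S M N m x)) t)"

text \<open>The additive subgroup of \<open>P\<close> generated by all products \<open>f x y\<close> with \<open>x \<in> X\<close> and \<open>y \<in> Y\<close>.\<close>

definition span_prod ::
  "('p, 'z) ring_scheme \<Rightarrow> ('x \<Rightarrow> 'y \<Rightarrow> 'p) \<Rightarrow> 'x set \<Rightarrow> 'y set \<Rightarrow> 'p set" where
  "span_prod P f X Y = generate (add_monoid P) {f x y | x y. x \<in> X \<and> y \<in> Y}"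


section \<open>Generalized matrix rings\<close>

text \<open>The ring \<open>R\<^sub>i\<close> is \<open>M i i\<close>; all \<open>R\<^sub>i\<close> are unital (\<^locale>\<open>ring\<close> is the locale of unital rings).
  A common carrier type for all the \<open>M i j\<close> is no restriction, as finitely many sets
  embed into one type.\<close>

definition gm_mult where
  "gm_mult M \<theta> i j k x y = \<theta> i j k (pure_tensor (M j j) (M i j) (M j k) x y)"

locale generalized_matrix_ring =
  fixes n :: nat
    and M :: "nat \<Rightarrow> nat \<Rightarrow> ('a, 'a, 'a) bimod"
    and \<theta> :: "nat \<Rightarrow> nat \<Rightarrow> nat \<Rightarrow> (('a \<times> 'a) \<Rightarrow>\<^sub>0 int) set \<Rightarrow> 'a"
  assumes diagonal_ring: "i \<in> {1..n} \<Longrightarrow> ring (M i i)"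
    and entry_bimodule: "\<lbrakk>i \<in> {1..n}; j \<in> {1..n}\<rbrakk> \<Longrightarrow> unital_bimodule (M i i) (M j j) (M i j)"
    and theta_hom: "\<lbrakk>i \<in> {1..n}; j \<in> {1..n}; k \<in> {1..n}\<rbrakk>
      \<Longrightarrow> tensor_bimodule_hom (M i i) (M j j) (M k k) (M i j) (M j k) (M i k) (\<theta> i j k)"
    and theta_ring: "\<lbrakk>i \<in> {1..n}; x \<in> carrier (M i i); y \<in> carrier (M i i)\<rbrakk>
      \<Longrightarrow> gm_mult M \<theta> i i i x y = x \<otimes>\<^bsub>M i i\<^esub> y"
    and theta_lact: "\<lbrakk>i \<in> {1..n}; j \<in> {1..n}; r \<in> carrier (M i i); m \<in> carrier (M i j)\<rbrakk>
      \<Longrightarrow> gm_mult M \<theta> i i j r m = lact (M i j) r m"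
    and theta_ract: "\<lbrakk>i \<in> {1..n}; j \<in> {1..n}; m \<in> carrier (M i j); s \<in> carrier (M j j)\<rbrakk>
      \<Longrightarrow> gm_mult M \<theta> i j j m s = ract (M i j) m s"
    and theta_assoc: "\<lbrakk>i \<in> {1..n}; j \<in> {1..n}; k \<in> {1..n}; l \<in> {1..n};
        x \<in> carrier (M i j); y \<in> carrier (M j k); z \<in> carrier (M k l)\<rbrakk>
      \<Longrightarrow> gm_mult M \<theta> i k l (gm_mult M \<theta> i j k x y) z =
          gm_mult M \<theta> i j l x (gm_mult M \<theta> j k l y z)"


section \<open>Partial actions\<close>

text \<open>Ideals are rings that need not have a unit, so ring isomorphisms between them are additive
  and multiplicative bijections (the library notion would force the unit to be preserved).\<close>

definition ideal_iso :: "('a, 'x) ring_scheme \<Rightarrow> 'a set \<Rightarrow> 'a set \<Rightarrow> ('a \<Rightarrow> 'a) \<Rightarrow> bool" where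
  "ideal_iso A I J f \<longleftrightarrow> bij_betw f I J \<and>
     (\<forall>x \<in> I. \<forall>y \<in> I. f (x \<oplus>\<^bsub>A\<^esub> y) = f x \<oplus>\<^bsub>A\<^esub> f y \<and> f (x \<otimes>\<^bsub>A\<^esub> y) = f x \<otimes>\<^bsub>A\<^esub> f y)"

locale partial_action = G: group G + A: ring A
  for G :: "('g, 'x) monoid_scheme" and A :: "('a, 'y) ring_scheme" +
  fixes D :: "'g \<Rightarrow> 'a set" and \<alpha> :: "'g \<Rightarrow> 'a \<Rightarrow> 'a"
  assumes ideals: "g \<in> carrier G \<Longrightarrow> ideal (D g) A"
    and isos: "g \<in> carrier G \<Longrightarrow> ideal_iso A (D (inv\<^bsub>G\<^esub> g)) (D g) (\<alpha> g)"
    and D_one: "D \<one>\<^bsub>G\<^esub> = carrier A"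
    and action_one: "a \<in> carrier A \<Longrightarrow> \<alpha> \<one>\<^bsub>G\<^esub> a = a"
    and domains: "\<lbrakk>g \<in> carrier G; h \<in> carrier G\<rbrakk>
      \<Longrightarrow> \<alpha> (inv\<^bsub>G\<^esub> h) ` (D h \<inter> D (inv\<^bsub>G\<^esub> g)) \<subseteq> D (inv\<^bsub>G\<^esub> (g \<otimes>\<^bsub>G\<^esub> h))"
    and action_mult: "\<lbrakk>g \<in> carrier G; h \<in> carrier G;
        a \<in> D (inv\<^bsub>G\<^esub> h); \<alpha> h a \<in> D h \<inter> D (inv\<^bsub>G\<^esub> g)\<rbrakk>
      \<Longrightarrow> \<alpha> g (\<alpha> h a) = \<alpha> (g \<otimes>\<^bsub>G\<^esub> h) a"

text \<open>Only used for nonempty lists.\<close>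

fun ideal_prod_list :: "('a, 'x) ring_scheme \<Rightarrow> 'a set list \<Rightarrow> 'a set" where
  "ideal_prod_list A [] = carrier A"
| "ideal_prod_list A [I] = I"
| "ideal_prod_list A (I # J # Is) = ideal_prod A I (ideal_prod_list A (J # Is))"

definition regular_action ::
  "('g, 'x) monoid_scheme \<Rightarrow> ('a, 'y) ring_scheme \<Rightarrow> ('g \<Rightarrow> 'a set) \<Rightarrow> bool" where
  "regular_action G A D \<longleftrightarrow>
     (\<forall>gs. gs \<noteq> [] \<and> set gs \<subseteq> carrier G \<longrightarrow> (\<Inter>g \<in> set gs. D g) = ideal_prod_list A (map D gs))"

locale product_partial_action = G: group G + A: ring A
  for G :: "('g, 'x) monoid_scheme" and A :: "('a, 'y) ring_scheme" +
  fixes D :: "'g \<Rightarrow> 'a set" and \<alpha> :: "'g \<Rightarrow> 'a \<Rightarrow> 'a"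
  assumes ideals: "g \<in> carrier G \<Longrightarrow> ideal (D g) A"
    and isos: "g \<in> carrier G \<Longrightarrow> ideal_iso A (D (inv\<^bsub>G\<^esub> g)) (D g) (\<alpha> g)"
    and D_one: "D \<one>\<^bsub>G\<^esub> = carrier A"
    and action_one: "a \<in> carrier A \<Longrightarrow> \<alpha> \<one>\<^bsub>G\<^esub> a = a"
    and idempotent: "g \<in> carrier G \<Longrightarrow> D g \<cdot>\<^bsub>A\<^esub> D g = D g"
    and commute: "\<lbrakk>g \<in> carrier G; h \<in> carrier G\<rbrakk> \<Longrightarrow> D g \<cdot>\<^bsub>A\<^esub> D h = D h \<cdot>\<^bsub>A\<^esub> D g"
    and action_image: "\<lbrakk>g \<in> carrier G; h \<in> carrier G\<rbrakk>
      \<Longrightarrow> \<alpha> g ` (D (inv\<^bsub>G\<^esub> g) \<cdot>\<^bsub>A\<^esub> D h) = D g \<cdot>\<^bsub>A\<^esub> D (g \<otimes>\<^bsub>G\<^esub> h)"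
    and action_mult: "\<lbrakk>g \<in> carrier G; h \<in> carrier G;
        a \<in> D (inv\<^bsub>G\<^esub> h) \<cdot>\<^bsub>A\<^esub> D (inv\<^bsub>G\<^esub> (g \<otimes>\<^bsub>G\<^esub> h))\<rbrakk>
      \<Longrightarrow> \<alpha> g (\<alpha> h a) = \<alpha> (g \<otimes>\<^bsub>G\<^esub> h) a"


section \<open>Partial actions on algebras\<close>

text \<open>The library locale \<^locale>\<open>algebra\<close> requires a commutative multiplication.\<close>

locale k_algebra = module K A + A: ring A
  for K :: "('k, 'x) ring_scheme" and A :: "('k, 'a, 'y) module_scheme" +
  assumes smult_mult_left: "\<lbrakk>c \<in> carrier K; a \<in> carrier A; b \<in> carrier A\<rbrakk>
      \<Longrightarrow> (c \<odot>\<^bsub>A\<^esub> a) \<otimes>\<^bsub>A\<^esub> b = c \<odot>\<^bsub>A\<^esub> (a \<otimes>\<^bsub>A\<^esub> b)"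
    and smult_mult_right: "\<lbrakk>c \<in> carrier K; a \<in> carrier A; b \<in> carrier A\<rbrakk>
      \<Longrightarrow> a \<otimes>\<^bsub>A\<^esub> (c \<odot>\<^bsub>A\<^esub> b) = c \<odot>\<^bsub>A\<^esub> (a \<otimes>\<^bsub>A\<^esub> b)"

definition with_smult :: "('a, 'x) ring_scheme \<Rightarrow> ('k \<Rightarrow> 'a \<Rightarrow> 'a) \<Rightarrow> ('k, 'a) module" where
  "with_smult A s = \<lparr>carrier = carrier A, mult = mult A, one = one A, zero = zero A, add = add A,
     smult = s\<rparr>"

text \<open>As \<open>A\<close> is unital, its ring ideals are closed under scalar multiplication.\<close>

locale algebra_partial_action = k_algebra K A + partial_action G A D \<alpha>
  for K :: "('k, 'x) ring_scheme" and G :: "('g, 'y) monoid_scheme"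
    and A :: "('k, 'a, 'z) module_scheme" and D \<alpha> +
  assumes linear: "\<lbrakk>g \<in> carrier G; c \<in> carrier K; a \<in> D (inv\<^bsub>G\<^esub> g)\<rbrakk>
      \<Longrightarrow> \<alpha> g (c \<odot>\<^bsub>A\<^esub> a) = c \<odot>\<^bsub>A\<^esub> \<alpha> g a"


section \<open>Data for generalized matrix rings\<close>

definition left_part :: "('r, 's, 'm, 'x) bimod_scheme \<Rightarrow> 'r set \<Rightarrow> 'm set" where
  "left_part M I = span_prod M (lact M) I (carrier M)"

definition right_part :: "('r, 's, 'm, 'x) bimod_scheme \<Rightarrow> 's set \<Rightarrow> 'm set" where
  "right_part M I = span_prod M (ract M) (carrier M) I"

locale datum = G: group G + generalized_matrix_ring n M \<theta>
  for G :: "('g, 'x) monoid_scheme" and n :: nat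
    and M :: "nat \<Rightarrow> nat \<Rightarrow> ('a, 'a, 'a) bimod" and \<theta> +
  fixes D :: "nat \<Rightarrow> 'g \<Rightarrow> 'a set"
    and \<alpha> :: "nat \<Rightarrow> 'g \<Rightarrow> 'a \<Rightarrow> 'a"
    and \<gamma> :: "nat \<Rightarrow> nat \<Rightarrow> 'g \<Rightarrow> 'a \<Rightarrow> 'a"
  assumes partial_actions: "i \<in> {1..n} \<Longrightarrow> partial_action G (M i i) (D i) (\<alpha> i)"
    and gamma_bij: "\<lbrakk>g \<in> carrier G; i \<in> {1..n}; j \<in> {1..n}\<rbrakk>
      \<Longrightarrow> bij_betw (\<gamma> i j g) (left_part (M i j) (D i (inv\<^bsub>G\<^esub> g))) (left_part (M i j) (D i g))"
    and gamma_add: "\<lbrakk>g \<in> carrier G; i \<in> {1..n}; j \<in> {1..n};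
        u \<in> left_part (M i j) (D i (inv\<^bsub>G\<^esub> g)); v \<in> left_part (M i j) (D i (inv\<^bsub>G\<^esub> g))\<rbrakk>
      \<Longrightarrow> \<gamma> i j g (u \<oplus>\<^bsub>M i j\<^esub> v) = \<gamma> i j g u \<oplus>\<^bsub>M i j\<^esub> \<gamma> i j g v"
    and left_right: "\<lbrakk>g \<in> carrier G; i \<in> {1..n}; j \<in> {1..n}\<rbrakk>
      \<Longrightarrow> left_part (M i j) (D i g) = right_part (M i j) (D j g)"
    and gamma_diagonal: "\<lbrakk>g \<in> carrier G; i \<in> {1..n}; a \<in> D i (inv\<^bsub>G\<^esub> g)\<rbrakk>
      \<Longrightarrow> \<gamma> i i g a = \<alpha> i g a"
    and gamma_one: "\<lbrakk>i \<in> {1..n}; j \<in> {1..n}; m \<in> carrier (M i j)\<rbrakk> \<Longrightarrow> \<gamma> i j \<one>\<^bsub>G\<^esub> m = m"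
    and gamma_product: "\<lbrakk>g \<in> carrier G; i \<in> {1..n}; j \<in> {1..n}; k \<in> {1..n};
        u \<in> left_part (M i k) (D i (inv\<^bsub>G\<^esub> g)); v \<in> left_part (M k j) (D k (inv\<^bsub>G\<^esub> g))\<rbrakk>
      \<Longrightarrow> gm_mult M \<theta> i k j (\<gamma> i k g u) (\<gamma> k j g v) = \<gamma> i j g (gm_mult M \<theta> i k j u v)"
    and gamma_domains: "\<lbrakk>g \<in> carrier G; h \<in> carrier G; i \<in> {1..n}; j \<in> {1..n};
        a \<in> left_part (M i j) (D i (inv\<^bsub>G\<^esub> h));
        \<gamma> i j h a \<in> left_part (M i j) (D i (inv\<^bsub>G\<^esub> g)) \<inter> left_part (M i j) (D i h)\<rbrakk>
      \<Longrightarrow> a \<in> left_part (M i j) (D i (inv\<^bsub>G\<^esub> (g \<otimes>\<^bsub>G\<^esub> h)))"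
    and gamma_mult: "\<lbrakk>g \<in> carrier G; h \<in> carrier G; i \<in> {1..n}; j \<in> {1..n};
        a \<in> left_part (M i j) (D i (inv\<^bsub>G\<^esub> h));
        \<gamma> i j h a \<in> left_part (M i j) (D i (inv\<^bsub>G\<^esub> g)) \<inter> left_part (M i j) (D i h)\<rbrakk>
      \<Longrightarrow> \<gamma> i j g (\<gamma> i j h a) = \<gamma> i j (g \<otimes>\<^bsub>G\<^esub> h) a"


section \<open>Morita equivalence\<close>

locale morita_context =
  M: unital_bimodule A A' M + M': unital_bimodule A' A M'
  for A :: "('a, 'x) ring_scheme" and A' :: "('b, 'y) ring_scheme"
    and M :: "('a, 'b, 'm) bimod" and M' :: "('b, 'a, 'p) bimod" +
  fixes \<tau> :: "(('m \<times> 'p) \<Rightarrow>\<^sub>0 int) set \<Rightarrow> 'a" and \<tau>' :: "(('p \<times> 'm) \<Rightarrow>\<^sub>0 int) set \<Rightarrow> 'b"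
  assumes tau_hom: "tensor_bimodule_hom A A' A M M' (ring_bimod A) \<tau>"
    and tau'_hom: "tensor_bimodule_hom A' A A' M' M (ring_bimod A') \<tau>'"
    and tau_assoc: "\<lbrakk>x \<in> carrier M; y \<in> carrier M'; z \<in> carrier M\<rbrakk>
      \<Longrightarrow> lact M (\<tau> (pure_tensor A' M M' x y)) z = ract M x (\<tau>' (pure_tensor A M' M y z))"
    and tau'_assoc: "\<lbrakk>y \<in> carrier M'; x \<in> carrier M; w \<in> carrier M'\<rbrakk>
      \<Longrightarrow> lact M' (\<tau>' (pure_tensor A M' M y x)) w = ract M' y (\<tau> (pure_tensor A' M M' x w))"

text \<open>The quadruple \<open>(a, m, m', a')\<close> stands for the matrix with rows \<open>(a, m)\<close> and \<open>(m', a')\<close>.\<close>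

definition morita_ring ::
  "('a, 'x) ring_scheme \<Rightarrow> ('b, 'y) ring_scheme \<Rightarrow> ('a, 'b, 'm) bimod \<Rightarrow> ('b, 'a, 'p) bimod
    \<Rightarrow> ((('m \<times> 'p) \<Rightarrow>\<^sub>0 int) set \<Rightarrow> 'a) \<Rightarrow> ((('p \<times> 'm) \<Rightarrow>\<^sub>0 int) set \<Rightarrow> 'b)
    \<Rightarrow> ('a \<times> 'm \<times> 'p \<times> 'b) ring" where
  "morita_ring A A' M M' \<tau> \<tau>' = \<lparr>
     carrier = carrier A \<times> carrier M \<times> carrier M' \<times> carrier A',
     mult = (\<lambda>(a, m, m', a') (b, x, x', b').
       (a \<otimes>\<^bsub>A\<^esub> b \<oplus>\<^bsub>A\<^esub> \<tau> (pure_tensor A' M M' m x'),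
        lact M a x \<oplus>\<^bsub>M\<^esub> ract M m b',
        ract M' m' b \<oplus>\<^bsub>M'\<^esub> lact M' a' x',
        \<tau>' (pure_tensor A M' M m' x) \<oplus>\<^bsub>A'\<^esub> a' \<otimes>\<^bsub>A'\<^esub> b')),
     one = (\<one>\<^bsub>A\<^esub>, \<zero>\<^bsub>M\<^esub>, \<zero>\<^bsub>M'\<^esub>, \<one>\<^bsub>A'\<^esub>),
     zero = (\<zero>\<^bsub>A\<^esub>, \<zero>\<^bsub>M\<^esub>, \<zero>\<^bsub>M'\<^esub>, \<zero>\<^bsub>A'\<^esub>),
     add = (\<lambda>(a, m, m', a') (b, x, x', b').
       (a \<oplus>\<^bsub>A\<^esub> b, m \<oplus>\<^bsub>M\<^esub> x, m' \<oplus>\<^bsub>M'\<^esub> x', a' \<oplus>\<^bsub>A'\<^esub> b'))\<rparr>"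

text \<open>The restriction of \<open>\<theta>\<close>, with domains \<open>E g\<close>, to the image of the embedding \<open>\<iota>\<close> of \<open>A\<close> is the
  partial action \<open>\<alpha>\<close> with domains \<open>D g\<close>.\<close>

definition restricts_to where
  "restricts_to G A \<iota> E \<theta> D \<alpha> \<longleftrightarrow>
     (\<forall>g \<in> carrier G. {a \<in> carrier A. \<iota> a \<in> E g} = D g \<and>
        (\<forall>a \<in> D (inv\<^bsub>G\<^esub> g). \<theta> g (\<iota> a) = \<iota> (\<alpha> g a)))"

text \<open>The types \<open>'m\<close> and \<open>'p\<close> of the elements of the two bimodules of the context have to be fixed in
  advance, since one cannot quantify over types; a witness in any two types yields Morita
  equivalence in the usual sense.  The bimodules and the product partial action refer to the
  ring structures only; the scalars enter through \<^locale>\<open>algebra_partial_action\<close>.\<close>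

definition morita_equivalent ::
  "'m itself \<Rightarrow> 'p itself \<Rightarrow> ('k, 'x) ring_scheme \<Rightarrow> ('g, 'y) monoid_scheme
    \<Rightarrow> ('k, 'a) module \<Rightarrow> ('g \<Rightarrow> 'a set) \<Rightarrow> ('g \<Rightarrow> 'a \<Rightarrow> 'a)
    \<Rightarrow> ('k, 'b) module \<Rightarrow> ('g \<Rightarrow> 'b set) \<Rightarrow> ('g \<Rightarrow> 'b \<Rightarrow> 'b) \<Rightarrow> bool" where
  "morita_equivalent _ _ K G A D \<alpha> A' D' \<alpha>' \<longleftrightarrow>
     algebra_partial_action K G A D \<alpha> \<and> regular_action G A D \<and>
     algebra_partial_action K G A' D' \<alpha>' \<and> regular_action G A' D' \<and>
     (\<exists>(M :: ('a, 'b, 'm) bimod) (M' :: ('b, 'a, 'p) bimod) \<tau> \<tau>'.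
        morita_context A A' M M' \<tau> \<tau>' \<and>
        \<tau> ` carrier (tensor_product A' M M') = carrier A \<and>
        \<tau>' ` carrier (tensor_product A M' M) = carrier A' \<and>
        (\<forall>g \<in> carrier G.
           span_prod A' (\<lambda>m' m. \<tau>' (pure_tensor A M' M m' m)) (carrier M') (left_part M (D g))
             = D' g) \<and>
        (\<exists>E \<theta>. product_partial_action G (morita_ring A A' M M' \<tau> \<tau>') E \<theta> \<and>
           restricts_to G A (\<lambda>a. (a, \<zero>\<^bsub>M\<^esub>, \<zero>\<^bsub>M'\<^esub>, \<zero>\<^bsub>A'\<^esub>)) E \<theta> D \<alpha> \<and>
           restricts_to G A' (\<lambda>a'. (\<zero>\<^bsub>A\<^esub>, \<zero>\<^bsub>M\<^esub>, \<zero>\<^bsub>M'\<^esub>, a')) E \<theta> D' \<alpha>'))"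

end

theory Submission
  imports Defs
begin

text \<open>The bimodules \<open>M i j\<close> and \<open>M j i\<close>, paired by the given products, form a Morita context between the
  rings \<open>R\<^sub>i\<close> and \<open>R\<^sub>j\<close>: its axioms are instances of the associativity of the generalized matrix
  ring, and \<open>M i j M j i = R\<^sub>i\<close>, \<open>M j i M i j = R\<^sub>j\<close> say that both pairings are onto.  Its Morita ring is the
  block of the generalized matrix ring with rows and columns \<open>i\<close> and \<open>j\<close>.  Put
  \<open>E g = (D i g, D i g M i j; D j g M j i, D j g)\<close>, and let \<open>g\<close> act on this block entrywise by the maps
  \<open>\<gamma>\<close>.  Since \<open>D i g M i j = M i j D j g\<close>, each \<open>E g\<close> is an ideal, and the axioms of a datum, read
  entry by entry, say that this is a partial action (\<open>block_partial_action\<close>).  It restricts to the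
  given partial actions on the two diagonal corners.  Moreover
  \<open>M j i D i g M i j = M j i M i j D j g = D j g\<close>, as Morita equivalence demands.

  What remains is to make it a product partial action.  This follows formally from
  \<open>E g \<inter> E h = E g E h\<close> (\<open>partial_action_imp_product_partial_action\<close>), because products of the
  domains may then be replaced by the intersections that occur in the axioms of a partial
  action.  The idempotent \<open>e\<close> of the block that belongs to \<open>R\<^sub>i\<close> generates the block as an ideal because of
  \<open>M j i M i j = R\<^sub>j\<close>, so ideals of the block are determined by their corners at \<open>e\<close>
  (\<open>ideal_subset_of_full_corner\<close>).  For the ideals in question the corners are \<open>D i g \<inter> D i h\<close> and
  \<open>D i g D i h\<close>, which agree by the regularity of the partial action on \<open>R\<^sub>i\<close>.\<close>

section \<open>Additive maps and spans of products\<close>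

text \<open>Statements about a span of products are reduced to the products themselves by this lemma:
  the elements that an additive map sends into a given subgroup form a subgroup.\<close>

lemma additive_map_span_prod:
  assumes P: "abelian_group P" and Q: "abelian_group Q"
    and closed: "\<And>x y. \<lbrakk>x \<in> X; y \<in> Y\<rbrakk> \<Longrightarrow> p x y \<in> carrier P"
    and f: "\<And>u. u \<in> carrier P \<Longrightarrow> f u \<in> carrier Q"
      "\<And>u v. \<lbrakk>u \<in> carrier P; v \<in> carrier P\<rbrakk> \<Longrightarrow> f (u \<oplus>\<^bsub>P\<^esub> v) = f u \<oplus>\<^bsub>Q\<^esub> f v"
    and H: "subgroup H (add_monoid Q)"
    and products: "\<And>x y. \<lbrakk>x \<in> X; y \<in> Y\<rbrakk> \<Longrightarrow> f (p x y) \<in> H"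
    and u: "u \<in> span_prod P p X Y"
  shows "f u \<in> H"
proof -
  interpret P: abelian_group P by fact
  interpret Q: abelian_group Q by fact
  interpret group_hom "add_monoid P" "add_monoid Q" f
    by unfold_locales (use f in \<open>auto simp: hom_def\<close>)
  let ?S = "{p x y | x y. x \<in> X \<and> y \<in> Y}"
  have "f ` generate (add_monoid P) ?S = generate (add_monoid Q) (f ` ?S)"
    by (rule generate_img [symmetric]) (use closed in auto)
  also have "\<dots> \<subseteq> H"
    by (rule Q.add.generate_subgroup_incl) (use products H in auto)
  finally show ?thesis
    using u by (auto simp: span_prod_def)
qed

lemma span_prod_subgroup:
  assumes "abelian_group P" and "\<And>x y. \<lbrakk>x \<in> X; y \<in> Y\<rbrakk> \<Longrightarrow> p x y \<in> carrier P"
  shows "subgroup (span_prod P p X Y) (add_monoid P)"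
proof -
  interpret P: abelian_group P by fact
  show ?thesis
    unfolding span_prod_def by (rule P.add.generate_is_subgroup) (use assms in auto)
qed

lemma span_prod_memI: "\<lbrakk>x \<in> X; y \<in> Y\<rbrakk> \<Longrightarrow> p x y \<in> span_prod P p X Y"
  unfolding span_prod_def by (rule generate.incl) blast

lemma span_prod_cong:
  assumes "\<And>x y. \<lbrakk>x \<in> X; y \<in> Y\<rbrakk> \<Longrightarrow> p x y = q x y"
  shows "span_prod P p X Y = span_prod P q X Y"
proof -
  have "{p x y | x y. x \<in> X \<and> y \<in> Y} = {q x y | x y. x \<in> X \<and> y \<in> Y}"
    using assms by metis
  then show ?thesis by (simp add: span_prod_def)
qed


section \<open>Tensor products\<close>

lemma generate_tensor_relations_normal:
  assumes "unital_bimodule R S M" and "unital_bimodule S T N"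
  shows "generate (free_Abelian_group (carrier M \<times> carrier N)) (tensor_relations S M N)
    \<lhd> free_Abelian_group (carrier M \<times> carrier N)"
proof -
  interpret M: unital_bimodule R S M by fact
  interpret N: unital_bimodule S T N by fact
  let ?F = "free_Abelian_group (carrier M \<times> carrier N)"
  interpret F: comm_group ?F by (rule abelian_free_Abelian_group)
  have diff: "a - b \<in> carrier ?F" if "a \<in> carrier ?F" "b \<in> carrier ?F" for a b
    using that keys_diff [of a b] by (auto simp: free_Abelian_group_def)
  have "tensor_relations S M N \<subseteq> carrier ?F"
    unfolding tensor_relations_def
    by (auto simp del: carrier_free_Abelian_group_iff intro!: diff M.ract_closed N.lact_closed)
  then show ?thesis
    by (intro F.subgroup_imp_normal F.generate_is_subgroup)
qed

lemma pure_tensor_closed: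
  assumes "m \<in> carrier M" and "x \<in> carrier N"
  shows "pure_tensor S M N m x \<in> carrier (tensor_product S M N)"
  using assms by (auto simp: pure_tensor_def tensor_product_def Let_def carrier_FactGroup
      simp del: carrier_free_Abelian_group_iff)

text \<open>The pure tensor of a sum and the product of the two pure tensors are cosets whose
  representatives differ by a defining relation.\<close>

lemma pure_tensor_add:
  assumes M: "unital_bimodule R S M" and N: "unital_bimodule S T N"
  shows pure_tensor_add_left: "\<lbrakk>m \<in> carrier M; m' \<in> carrier M; x \<in> carrier N\<rbrakk>
      \<Longrightarrow> pure_tensor S M N (m \<oplus>\<^bsub>M\<^esub> m') x =
        pure_tensor S M N m x \<otimes>\<^bsub>tensor_product S M N\<^esub> pure_tensor S M N m' x"
    and pure_tensor_add_right: "\<lbrakk>m \<in> carrier M; x \<in> carrier N; x' \<in> carrier N\<rbrakk>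
      \<Longrightarrow> pure_tensor S M N m (x \<oplus>\<^bsub>N\<^esub> x') =
        pure_tensor S M N m x \<otimes>\<^bsub>tensor_product S M N\<^esub> pure_tensor S M N m x'"
proof -
  interpret M: unital_bimodule R S M by fact
  interpret N: unital_bimodule S T N by fact
  let ?F = "free_Abelian_group (carrier M \<times> carrier N)"
  let ?N = "generate ?F (tensor_relations S M N)"
  interpret normal ?N ?F by (rule generate_tensor_relations_normal [OF M N])
  have coset_sum: "?N #>\<^bsub>?F\<^esub> frag_of c = (?N #>\<^bsub>?F\<^esub> frag_of a) <#>\<^bsub>?F\<^esub> (?N #>\<^bsub>?F\<^esub> frag_of b)"
    if rel: "frag_of c - frag_of a - frag_of b \<in> tensor_relations S M N"
      and "a \<in> carrier M \<times> carrier N" "b \<in> carrier M \<times> carrier N" for a b c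
  proof -
    let ?s = "frag_of a + frag_of b"
    have "frag_of a \<otimes>\<^bsub>?F\<^esub> frag_of b \<in> carrier ?F"
      by (rule m_closed) (use that in \<open>simp_all del: carrier_free_Abelian_group_iff\<close>)
    then have s: "?s \<in> carrier ?F" by (simp del: carrier_free_Abelian_group_iff)
    have "(frag_of c - frag_of a - frag_of b) \<otimes>\<^bsub>?F\<^esub> ?s \<in> ?N #>\<^bsub>?F\<^esub> ?s"
      using rel unfolding r_coset_def by (blast intro: generate.incl)
    then have "frag_of c \<in> ?N #>\<^bsub>?F\<^esub> ?s" by simp
    then have "?N #>\<^bsub>?F\<^esub> frag_of c = ?N #>\<^bsub>?F\<^esub> ?s"
      using repr_independence s subgroup_axioms by metis
    then show ?thesis
      using that by (simp add: rcos_sum del: carrier_free_Abelian_group_iff)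
  qed
  show "pure_tensor S M N (m \<oplus>\<^bsub>M\<^esub> m') x =
      pure_tensor S M N m x \<otimes>\<^bsub>tensor_product S M N\<^esub> pure_tensor S M N m' x"
    if "m \<in> carrier M" "m' \<in> carrier M" "x \<in> carrier N"
    unfolding pure_tensor_def tensor_product_def Let_def mult_FactGroup
    by (rule coset_sum) (use that in \<open>auto simp: tensor_relations_def\<close>)
  show "pure_tensor S M N m (x \<oplus>\<^bsub>N\<^esub> x') =
      pure_tensor S M N m x \<otimes>\<^bsub>tensor_product S M N\<^esub> pure_tensor S M N m x'"
    if "m \<in> carrier M" "x \<in> carrier N" "x' \<in> carrier N"
    unfolding pure_tensor_def tensor_product_def Let_def mult_FactGroup
    by (rule coset_sum) (use that in \<open>auto simp: tensor_relations_def\<close>)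
qed

lemma hom_tensor_image_span:
  assumes M: "unital_bimodule R S M" and N: "unital_bimodule S T N" and P: "abelian_group P"
    and f: "f \<in> hom (tensor_product S M N) (add_monoid P)"
  shows "span_prod P (\<lambda>m x. f (pure_tensor S M N m x)) (carrier M) (carrier N)
    \<subseteq> f ` carrier (tensor_product S M N)"
proof -
  interpret P: abelian_group P by fact
  interpret group_hom "tensor_product S M N" "add_monoid P" f
  proof (intro group_hom.intro group_hom_axioms.intro)
    show "group (tensor_product S M N)"
      unfolding tensor_product_def Let_def
      by (rule normal.factorgroup_is_group [OF generate_tensor_relations_normal [OF M N]])
  qed (use f P.add.group_axioms in auto)
  show ?thesis
    unfolding span_prod_def
    by (rule P.add.generate_subgroup_incl)
      (use img_is_subgroup in \<open>auto intro!: imageI pure_tensor_closed\<close>)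
qed


section \<open>Partial actions and product partial actions\<close>

text \<open>When products of domains are intersections, the image axiom of a product partial action
  reads \<open>\<alpha> g (D (g\<inverse>) \<inter> D h) = D g \<inter> D (g h)\<close>.  The inclusion \<open>\<subseteq>\<close> is the domain axiom of a partial
  action; applied to \<open>g\<inverse>\<close>, it yields the reverse inclusion, as \<open>\<alpha> g\<close> inverts \<open>\<alpha> (g\<inverse>)\<close>.\<close>

lemma partial_action_imp_product_partial_action:
  assumes "partial_action G A D \<alpha>"
    and regular: "\<And>g h. \<lbrakk>g \<in> carrier G; h \<in> carrier G\<rbrakk> \<Longrightarrow> D g \<inter> D h \<subseteq> D g \<cdot>\<^bsub>A\<^esub> D h"
  shows "product_partial_action G A D \<alpha>"
proof -
  interpret partial_action G A D \<alpha> by fact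
  have prod: "D g \<cdot>\<^bsub>A\<^esub> D h = D g \<inter> D h" if "g \<in> carrier G" "h \<in> carrier G" for g h
    using A.ideal_prod_inter ideals regular that by blast
  have maps: "\<alpha> g a \<in> D g" if "g \<in> carrier G" "a \<in> D (inv\<^bsub>G\<^esub> g)" for g a
    using isos [OF that(1)] that(2) by (auto simp: ideal_iso_def bij_betw_def)
  have forward: "\<alpha> g ` (D (inv\<^bsub>G\<^esub> g) \<inter> D h) \<subseteq> D g \<inter> D (g \<otimes>\<^bsub>G\<^esub> h)"
    if "g \<in> carrier G" "h \<in> carrier G" for g h
    using domains [of "inv\<^bsub>G\<^esub> h" "inv\<^bsub>G\<^esub> g"] maps that by (auto simp: G.inv_mult_group)
  have inverse: "\<alpha> g (\<alpha> (inv\<^bsub>G\<^esub> g) b) = b" if "g \<in> carrier G" "b \<in> D g" for g b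
  proof -
    have "\<alpha> g (\<alpha> (inv\<^bsub>G\<^esub> g) b) = \<alpha> (g \<otimes>\<^bsub>G\<^esub> inv\<^bsub>G\<^esub> g) b"
      by (rule action_mult) (use that maps [of "inv\<^bsub>G\<^esub> g" b] in auto)
    then show ?thesis
      using that action_one ideal.Icarr [OF ideals] by auto
  qed
  have image: "\<alpha> g ` (D (inv\<^bsub>G\<^esub> g) \<inter> D h) = D g \<inter> D (g \<otimes>\<^bsub>G\<^esub> h)"
    if g: "g \<in> carrier G" and h: "h \<in> carrier G" for g h
  proof
    show "D g \<inter> D (g \<otimes>\<^bsub>G\<^esub> h) \<subseteq> \<alpha> g ` (D (inv\<^bsub>G\<^esub> g) \<inter> D h)"
    proof
      fix b assume b: "b \<in> D g \<inter> D (g \<otimes>\<^bsub>G\<^esub> h)"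
      have "inv\<^bsub>G\<^esub> g \<otimes>\<^bsub>G\<^esub> (g \<otimes>\<^bsub>G\<^esub> h) = h"
        using g h by (simp flip: G.m_assoc)
      then have "\<alpha> (inv\<^bsub>G\<^esub> g) b \<in> D (inv\<^bsub>G\<^esub> g) \<inter> D h"
        using forward [of "inv\<^bsub>G\<^esub> g" "g \<otimes>\<^bsub>G\<^esub> h"] g h b by auto
      then show "b \<in> \<alpha> g ` (D (inv\<^bsub>G\<^esub> g) \<inter> D h)"
        using inverse [OF g, of b] b by (metis IntD1 imageI)
    qed
  qed (rule forward [OF g h])
  show ?thesis
  proof (intro product_partial_action.intro product_partial_action_axioms.intro
      G.group_axioms A.ring_axioms)
    fix g h a assume gh: "g \<in> carrier G" "h \<in> carrier G"
      and "a \<in> D (inv\<^bsub>G\<^esub> h) \<cdot>\<^bsub>A\<^esub> D (inv\<^bsub>G\<^esub> (g \<otimes>\<^bsub>G\<^esub> h))"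
    then have a: "a \<in> D (inv\<^bsub>G\<^esub> h) \<inter> D (inv\<^bsub>G\<^esub> (g \<otimes>\<^bsub>G\<^esub> h))"
      by (simp add: prod)
    have "h \<otimes>\<^bsub>G\<^esub> inv\<^bsub>G\<^esub> (g \<otimes>\<^bsub>G\<^esub> h) = inv\<^bsub>G\<^esub> g"
      using gh by (simp add: G.inv_mult_group flip: G.m_assoc)
    then have "\<alpha> h a \<in> D h \<inter> D (inv\<^bsub>G\<^esub> g)"
      using forward [of h "inv\<^bsub>G\<^esub> (g \<otimes>\<^bsub>G\<^esub> h)"] gh a by auto
    then show "\<alpha> g (\<alpha> h a) = \<alpha> (g \<otimes>\<^bsub>G\<^esub> h) a"
      using action_mult gh a by blast
  next
    show "D g \<cdot>\<^bsub>A\<^esub> D h = D h \<cdot>\<^bsub>A\<^esub> D g" if "g \<in> carrier G" "h \<in> carrier G" for g h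
      using that by (simp add: prod Int_commute)
  qed (simp_all add: ideals isos D_one action_one prod image)
qed


section \<open>Full corners of a ring\<close>

text \<open>The hypothesis \<open>full\<close> says that \<open>e\<close> generates the unit ideal \<open>R e R\<close>, and then
  \<open>I = (R e R) I (R e R) \<subseteq> R (e I e) R \<subseteq> J\<close>.  Instead of writing \<open>1\<close> as a sum of products \<open>u e v\<close>, the
  proof removes the two factors \<open>e\<close> one after the other: the elements \<open>y\<close> with \<open>e I y \<subseteq> J\<close>, and then
  those with \<open>y I \<subseteq> J\<close>, form an ideal that contains \<open>e\<close>, hence \<open>1\<close>.\<close>

lemma (in ring) ideal_subset_of_full_corner:
  assumes e: "e \<in> carrier R"
    and full: "\<And>S. \<lbrakk>ideal S R; e \<in> S\<rbrakk> \<Longrightarrow> \<one> \<in> S"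
    and I: "ideal I R" and J: "ideal J R"
    and corner: "\<And>x. x \<in> I \<Longrightarrow> e \<otimes> x \<otimes> e \<in> J"
  shows "I \<subseteq> J"
proof -
  interpret I: ideal I R by fact
  interpret J: ideal J R by fact
  let ?S = "{y \<in> carrier R. \<forall>x \<in> I. e \<otimes> x \<otimes> y \<in> J}"
  have "ideal ?S R"
  proof (rule idealI [OF ring_axioms])
    show "subgroup ?S (add_monoid R)"
      by (rule add.subgroupI)
        (auto simp: r_distr r_minus e I.Icarr simp flip: a_inv_def intro!: exI [of _ \<zero>] J.a_inv_closed)
  next
    fix y r assume "y \<in> ?S" "r \<in> carrier R"
    then show "r \<otimes> y \<in> ?S"
      using e by (auto simp: m_assoc I.Icarr) (metis I.I_r_closed I.Icarr m_assoc)
    show "y \<otimes> r \<in> ?S"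
      using e J.I_r_closed \<open>y \<in> ?S\<close> \<open>r \<in> carrier R\<close> by (auto simp: I.Icarr simp flip: m_assoc)
  qed
  then have "\<one> \<in> ?S"
    using e corner by (intro full) auto
  then have left: "e \<otimes> x \<in> J" if "x \<in> I" for x
    using that e by (auto simp: I.Icarr)
  let ?T = "{y \<in> carrier R. \<forall>x \<in> I. y \<otimes> x \<in> J}"
  have "ideal ?T R"
  proof (rule idealI [OF ring_axioms])
    show "subgroup ?T (add_monoid R)"
      by (rule add.subgroupI)
        (auto simp: l_distr l_minus e I.Icarr simp flip: a_inv_def intro!: exI [of _ \<zero>] J.a_inv_closed)
  qed (use e I.I_l_closed J.I_l_closed in \<open>auto simp: m_assoc I.Icarr\<close>)
  then have "\<one> \<in> ?T"
    using e left by (intro full) auto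
  then show ?thesis
    by (auto simp: I.Icarr)
qed


section \<open>The multiplication of a generalized matrix ring\<close>

context generalized_matrix_ring
begin

lemma entry_abelian_group: "\<lbrakk>i \<in> {1..n}; j \<in> {1..n}\<rbrakk> \<Longrightarrow> abelian_group (M i j)"
  using entry_bimodule unital_bimodule.axioms(3) by blast

context
  fixes i j k
  assumes ijk: "i \<in> {1..n}" "j \<in> {1..n}" "k \<in> {1..n}"
begin

lemma gm_closed:
  assumes "x \<in> carrier (M i j)" and "y \<in> carrier (M j k)"
  shows "gm_mult M \<theta> i j k x y \<in> carrier (M i k)"
  using theta_hom [OF ijk] pure_tensor_closed [OF assms]
  by (auto simp: tensor_bimodule_hom_def hom_def gm_mult_def)

lemma gm_add_left:
  assumes "x \<in> carrier (M i j)" and "x' \<in> carrier (M i j)" and "y \<in> carrier (M j k)"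
  shows "gm_mult M \<theta> i j k (x \<oplus>\<^bsub>M i j\<^esub> x') y =
    gm_mult M \<theta> i j k x y \<oplus>\<^bsub>M i k\<^esub> gm_mult M \<theta> i j k x' y"
  using theta_hom [OF ijk] assms
  by (auto simp: tensor_bimodule_hom_def hom_def gm_mult_def pure_tensor_closed
      pure_tensor_add_left [OF entry_bimodule [OF ijk(1,2)] entry_bimodule [OF ijk(2,3)]])

lemma gm_add_right:
  assumes "x \<in> carrier (M i j)" and "y \<in> carrier (M j k)" and "y' \<in> carrier (M j k)"
  shows "gm_mult M \<theta> i j k x (y \<oplus>\<^bsub>M j k\<^esub> y') =
    gm_mult M \<theta> i j k x y \<oplus>\<^bsub>M i k\<^esub> gm_mult M \<theta> i j k x y'"
  using theta_hom [OF ijk] assms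
  by (auto simp: tensor_bimodule_hom_def hom_def gm_mult_def pure_tensor_closed
      pure_tensor_add_right [OF entry_bimodule [OF ijk(1,2)] entry_bimodule [OF ijk(2,3)]])

lemma gm_zero_left:
  assumes "y \<in> carrier (M j k)"
  shows "gm_mult M \<theta> i j k \<zero>\<^bsub>M i j\<^esub> y = \<zero>\<^bsub>M i k\<^esub>"
proof -
  interpret A: abelian_group "M i j" by (rule entry_abelian_group [OF ijk(1,2)])
  interpret B: abelian_group "M i k" by (rule entry_abelian_group [OF ijk(1,3)])
  show ?thesis
    using gm_add_left [of "\<zero>\<^bsub>M i j\<^esub>" "\<zero>\<^bsub>M i j\<^esub>" y] gm_closed [of "\<zero>\<^bsub>M i j\<^esub>" y] assms
    by simp
qed

lemma gm_zero_right:
  assumes "x \<in> carrier (M i j)"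
  shows "gm_mult M \<theta> i j k x \<zero>\<^bsub>M j k\<^esub> = \<zero>\<^bsub>M i k\<^esub>"
proof -
  interpret A: abelian_group "M j k" by (rule entry_abelian_group [OF ijk(2,3)])
  interpret B: abelian_group "M i k" by (rule entry_abelian_group [OF ijk(1,3)])
  show ?thesis
    using gm_add_right [of x "\<zero>\<^bsub>M j k\<^esub>" "\<zero>\<^bsub>M j k\<^esub>"] gm_closed [of x "\<zero>\<^bsub>M j k\<^esub>"] assms
    by simp
qed

end

lemma one_closed: "i \<in> {1..n} \<Longrightarrow> \<one>\<^bsub>M i i\<^esub> \<in> carrier (M i i)"
  using diagonal_ring ring.ring_simprules(6) by blast

lemma gm_one_left:
  assumes "i \<in> {1..n}" "j \<in> {1..n}" and "x \<in> carrier (M i j)"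
  shows "gm_mult M \<theta> i i j \<one>\<^bsub>M i i\<^esub> x = x"
  using assms theta_lact one_closed unital_bimodule.lact_one [OF entry_bimodule] by simp

lemma gm_one_right:
  assumes "i \<in> {1..n}" "j \<in> {1..n}" and "x \<in> carrier (M i j)"
  shows "gm_mult M \<theta> i j j x \<one>\<^bsub>M j j\<^esub> = x"
  using assms theta_ract one_closed unital_bimodule.ract_one [OF entry_bimodule] by simp

text \<open>Associativity of the multiplication of two-by-two blocks at the entry \<open>(p, q)\<close>: \<open>(x, x')\<close> is
  row \<open>p\<close> of the first factor, \<open>(a, b; c, d)\<close> the second factor, and \<open>(z, z')\<close> column \<open>q\<close> of the
  third.\<close>

lemma gm_assoc_row_column:
  assumes ij: "i \<in> {1..n}" "j \<in> {1..n}" and pq: "p \<in> {1..n}" "q \<in> {1..n}"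
    and x: "x \<in> carrier (M p i)" "x' \<in> carrier (M p j)"
    and y: "a \<in> carrier (M i i)" "b \<in> carrier (M i j)" "c \<in> carrier (M j i)" "d \<in> carrier (M j j)"
    and z: "z \<in> carrier (M i q)" "z' \<in> carrier (M j q)"
  shows "gm_mult M \<theta> p i q (gm_mult M \<theta> p i i x a \<oplus>\<^bsub>M p i\<^esub> gm_mult M \<theta> p j i x' c) z \<oplus>\<^bsub>M p q\<^esub>
      gm_mult M \<theta> p j q (gm_mult M \<theta> p i j x b \<oplus>\<^bsub>M p j\<^esub> gm_mult M \<theta> p j j x' d) z' =
    gm_mult M \<theta> p i q x (gm_mult M \<theta> i i q a z \<oplus>\<^bsub>M i q\<^esub> gm_mult M \<theta> i j q b z') \<oplus>\<^bsub>M p q\<^esub>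
      gm_mult M \<theta> p j q x' (gm_mult M \<theta> j i q c z \<oplus>\<^bsub>M j q\<^esub> gm_mult M \<theta> j j q d z')"
proof -
  interpret B: abelian_group "M p q" by (rule entry_abelian_group [OF pq])
  \<comment> \<open>Expanding the products turns the claim into an exchange of the two middle summands.\<close>
  have interchange: "(u \<oplus>\<^bsub>M p q\<^esub> v) \<oplus>\<^bsub>M p q\<^esub> (u' \<oplus>\<^bsub>M p q\<^esub> v') = (u \<oplus>\<^bsub>M p q\<^esub> u') \<oplus>\<^bsub>M p q\<^esub> (v \<oplus>\<^bsub>M p q\<^esub> v')"
    if "u \<in> carrier (M p q)" "v \<in> carrier (M p q)" "u' \<in> carrier (M p q)" "v' \<in> carrier (M p q)"
    for u v u' v'
    using that by (simp add: B.a_ac)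
  note gm = ij pq x y z gm_closed
  show ?thesis
    by (simp only: gm_add_left gm_add_right theta_assoc gm)
      (rule interchange; intro gm)
qed

end


section \<open>The Morita ring of two diagonal entries\<close>

context generalized_matrix_ring
begin

text \<open>For \<open>i = j\<close> this is the ring of all two-by-two matrices over \<open>R\<^sub>i\<close>, so that this case needs no
  separate treatment.\<close>

abbreviation block_ring where
  "block_ring i j \<equiv> morita_ring (M i i) (M j j) (M i j) (M j i) (\<theta> i j i) (\<theta> j i j)"

context
  fixes i j
  assumes ij: "i \<in> {1..n}" "j \<in> {1..n}"
begin

lemma carrier_block_ring: "carrier (block_ring i j) =
    carrier (M i i) \<times> carrier (M i j) \<times> carrier (M j i) \<times> carrier (M j j)"
  by (simp add: morita_ring_def)

lemma add_block_ring: "(a, m, m', a') \<oplus>\<^bsub>block_ring i j\<^esub> (b, x, x', b') =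
    (a \<oplus>\<^bsub>M i i\<^esub> b, m \<oplus>\<^bsub>M i j\<^esub> x, m' \<oplus>\<^bsub>M j i\<^esub> x', a' \<oplus>\<^bsub>M j j\<^esub> b')"
  by (simp add: morita_ring_def)

lemma mult_block_ring:
  assumes "a \<in> carrier (M i i)" "m \<in> carrier (M i j)" "m' \<in> carrier (M j i)" "a' \<in> carrier (M j j)"
    and "b \<in> carrier (M i i)" "x \<in> carrier (M i j)" "x' \<in> carrier (M j i)" "b' \<in> carrier (M j j)"
  shows "(a, m, m', a') \<otimes>\<^bsub>block_ring i j\<^esub> (b, x, x', b') =
    (gm_mult M \<theta> i i i a b \<oplus>\<^bsub>M i i\<^esub> gm_mult M \<theta> i j i m x',
     gm_mult M \<theta> i i j a x \<oplus>\<^bsub>M i j\<^esub> gm_mult M \<theta> i j j m b',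
     gm_mult M \<theta> j i i m' b \<oplus>\<^bsub>M j i\<^esub> gm_mult M \<theta> j j i a' x',
     gm_mult M \<theta> j i j m' x \<oplus>\<^bsub>M j j\<^esub> gm_mult M \<theta> j j j a' b')"
proof -
  have "(a, m, m', a') \<otimes>\<^bsub>block_ring i j\<^esub> (b, x, x', b') =
    (a \<otimes>\<^bsub>M i i\<^esub> b \<oplus>\<^bsub>M i i\<^esub> gm_mult M \<theta> i j i m x',
     lact (M i j) a x \<oplus>\<^bsub>M i j\<^esub> ract (M i j) m b',
     ract (M j i) m' b \<oplus>\<^bsub>M j i\<^esub> lact (M j i) a' x',
     gm_mult M \<theta> j i j m' x \<oplus>\<^bsub>M j j\<^esub> a' \<otimes>\<^bsub>M j j\<^esub> b')"
    by (simp add: morita_ring_def gm_mult_def)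
  then show ?thesis
    using assms ij by (simp only: theta_ring theta_lact theta_ract)
qed

lemma ring_block_ring: "ring (block_ring i j)"
proof -
  interpret A: abelian_group "M i i" by (rule entry_abelian_group [OF ij(1) ij(1)])
  interpret B: abelian_group "M i j" by (rule entry_abelian_group [OF ij])
  interpret C: abelian_group "M j i" by (rule entry_abelian_group [OF ij(2) ij(1)])
  interpret E: abelian_group "M j j" by (rule entry_abelian_group [OF ij(2) ij(2)])
  let ?R = "block_ring i j"
  have zero: "\<zero>\<^bsub>?R\<^esub> = (\<zero>\<^bsub>M i i\<^esub>, \<zero>\<^bsub>M i j\<^esub>, \<zero>\<^bsub>M j i\<^esub>, \<zero>\<^bsub>M j j\<^esub>)"
    and one: "\<one>\<^bsub>?R\<^esub> = (\<one>\<^bsub>M i i\<^esub>, \<zero>\<^bsub>M i j\<^esub>, \<zero>\<^bsub>M j i\<^esub>, \<one>\<^bsub>M j j\<^esub>)"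
    by (simp_all add: morita_ring_def)
  note gm = ij gm_closed A.a_closed B.a_closed C.a_closed E.a_closed
    carrier_block_ring add_block_ring mult_block_ring mem_Times_iff fst_conv snd_conv
    split_paired_all prod.inject
  show ?thesis
  proof (rule ringI)
    show "abelian_group ?R"
    proof (rule abelian_groupI)
      fix x assume "x \<in> carrier ?R"
      then obtain a b c d where x: "x = (a, b, c, d)" and car: "a \<in> carrier (M i i)"
          "b \<in> carrier (M i j)" "c \<in> carrier (M j i)" "d \<in> carrier (M j j)"
        by (auto simp: carrier_block_ring)
      then show "\<exists>y \<in> carrier ?R. y \<oplus>\<^bsub>?R\<^esub> x = \<zero>\<^bsub>?R\<^esub>"
        by (intro bexI [of _ "(\<ominus>\<^bsub>M i i\<^esub> a, \<ominus>\<^bsub>M i j\<^esub> b, \<ominus>\<^bsub>M j i\<^esub> c, \<ominus>\<^bsub>M j j\<^esub> d)"])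
          (auto simp: add_block_ring carrier_block_ring zero A.l_neg B.l_neg C.l_neg E.l_neg)
    qed (auto simp: add_block_ring carrier_block_ring zero A.a_ac B.a_ac C.a_ac E.a_ac)
    show "monoid ?R"
    proof (rule monoidI)
      fix x y z assume xyz: "x \<in> carrier ?R" "y \<in> carrier ?R" "z \<in> carrier ?R"
      show "x \<otimes>\<^bsub>?R\<^esub> y \<in> carrier ?R"
        using xyz by (cases x rule: prod_cases4; cases y rule: prod_cases4; simp only: gm)
      show "x \<otimes>\<^bsub>?R\<^esub> y \<otimes>\<^bsub>?R\<^esub> z = x \<otimes>\<^bsub>?R\<^esub> (y \<otimes>\<^bsub>?R\<^esub> z)"
        using xyz
        by (cases x rule: prod_cases4; cases y rule: prod_cases4; cases z rule: prod_cases4;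
          simp only: gm gm_assoc_row_column)
    next
      fix x assume x: "x \<in> carrier ?R"
      show "\<one>\<^bsub>?R\<^esub> \<otimes>\<^bsub>?R\<^esub> x = x"
        using x
        by (cases x rule: prod_cases4; simp only: gm one one_closed A.zero_closed B.zero_closed C.zero_closed
            E.zero_closed gm_one_left gm_zero_left A.r_zero B.r_zero C.l_zero E.l_zero)
      show "x \<otimes>\<^bsub>?R\<^esub> \<one>\<^bsub>?R\<^esub> = x"
        using x
        by (cases x rule: prod_cases4; simp only: gm one one_closed A.zero_closed B.zero_closed C.zero_closed
            E.zero_closed gm_one_right gm_zero_right A.r_zero B.l_zero C.r_zero E.l_zero)
    qed (simp only: gm one one_closed B.zero_closed C.zero_closed)
  next
    fix x y z assume xyz: "x \<in> carrier ?R" "y \<in> carrier ?R" "z \<in> carrier ?R"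
    show "(x \<oplus>\<^bsub>?R\<^esub> y) \<otimes>\<^bsub>?R\<^esub> z = x \<otimes>\<^bsub>?R\<^esub> z \<oplus>\<^bsub>?R\<^esub> y \<otimes>\<^bsub>?R\<^esub> z"
      using xyz
      by (cases x rule: prod_cases4; cases y rule: prod_cases4; cases z rule: prod_cases4;
        simp only: gm gm_add_left; simp only: A.a_ac B.a_ac C.a_ac E.a_ac gm)
    show "z \<otimes>\<^bsub>?R\<^esub> (x \<oplus>\<^bsub>?R\<^esub> y) = z \<otimes>\<^bsub>?R\<^esub> x \<oplus>\<^bsub>?R\<^esub> z \<otimes>\<^bsub>?R\<^esub> y"
      using xyz
      by (cases x rule: prod_cases4; cases y rule: prod_cases4; cases z rule: prod_cases4;
        simp only: gm gm_add_right; simp only: A.a_ac B.a_ac C.a_ac E.a_ac gm)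
  qed
qed

text \<open>The ideal generated by the unit \<open>e\<close> of \<open>R\<^sub>i\<close> contains \<open>x e y = x y\<close> for \<open>x\<close> in \<open>M j i\<close> and \<open>y\<close> in \<open>M i j\<close>.
  By the surjectivity of the pairing it contains the unit of \<open>R\<^sub>j\<close> as well.\<close>

lemma corner_unit_full:
  assumes surj: "span_prod (M j j) (gm_mult M \<theta> j i j) (carrier (M j i)) (carrier (M i j)) = carrier (M j j)"
    and S: "ideal S (block_ring i j)"
    and e: "(\<one>\<^bsub>M i i\<^esub>, \<zero>\<^bsub>M i j\<^esub>, \<zero>\<^bsub>M j i\<^esub>, \<zero>\<^bsub>M j j\<^esub>) \<in> S"
  shows "\<one>\<^bsub>block_ring i j\<^esub> \<in> S"
proof -
  let ?R = "block_ring i j"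
  let ?e = "(\<one>\<^bsub>M i i\<^esub>, \<zero>\<^bsub>M i j\<^esub>, \<zero>\<^bsub>M j i\<^esub>, \<zero>\<^bsub>M j j\<^esub>)"
  interpret S: ideal S ?R by fact
  interpret A: abelian_group "M i i" by (rule entry_abelian_group [OF ij(1) ij(1)])
  interpret B: abelian_group "M i j" by (rule entry_abelian_group [OF ij])
  interpret C: abelian_group "M j i" by (rule entry_abelian_group [OF ij(2) ij(1)])
  interpret E: abelian_group "M j j" by (rule entry_abelian_group [OF ij(2) ij(2)])
  note calc = ij one_closed A.zero_closed B.zero_closed C.zero_closed E.zero_closed gm_closed
    gm_one_left gm_one_right gm_zero_left gm_zero_right
    A.r_zero B.r_zero C.r_zero E.r_zero A.l_zero B.l_zero C.l_zero E.l_zero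
  let ?f = "\<lambda>a'. (\<zero>\<^bsub>M i i\<^esub>, \<zero>\<^bsub>M i j\<^esub>, \<zero>\<^bsub>M j i\<^esub>, a')"
  have "?f \<one>\<^bsub>M j j\<^esub> \<in> S"
  proof (rule additive_map_span_prod [where f = ?f and Q = ?R and H = S])
    show "abelian_group (M j j)" "abelian_group ?R"
      by unfold_locales
    show "subgroup S (add_monoid ?R)"
      by (rule S.a_subgroup)
    show "\<one>\<^bsub>M j j\<^esub> \<in> span_prod (M j j) (gm_mult M \<theta> j i j) (carrier (M j i)) (carrier (M i j))"
      using surj one_closed ij by simp
    fix x y assume x: "x \<in> carrier (M j i)" and y: "y \<in> carrier (M i j)"
    let ?y = "(\<zero>\<^bsub>M i i\<^esub>, y, \<zero>\<^bsub>M j i\<^esub>, \<zero>\<^bsub>M j j\<^esub>)"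
    let ?x = "(\<zero>\<^bsub>M i i\<^esub>, \<zero>\<^bsub>M i j\<^esub>, x, \<zero>\<^bsub>M j j\<^esub>)"
    have "?x \<in> carrier ?R" "?y \<in> carrier ?R"
      using x y by (simp_all add: carrier_block_ring)
    moreover have "?f (gm_mult M \<theta> j i j x y) = ?x \<otimes>\<^bsub>?R\<^esub> (?e \<otimes>\<^bsub>?R\<^esub> ?y)"
      by (simp only: mult_block_ring calc x y)
    ultimately show "?f (gm_mult M \<theta> j i j x y) \<in> S"
      using S.I_l_closed S.I_r_closed e by metis
    show "gm_mult M \<theta> j i j x y \<in> carrier (M j j)"
      using x y by (rule gm_closed [OF ij(2,1,2)])
  qed (simp_all add: carrier_block_ring add_block_ring)
  then have "?e \<oplus>\<^bsub>?R\<^esub> ?f \<one>\<^bsub>M j j\<^esub> \<in> S"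
    by (rule additive_subgroup.a_closed [OF S.additive_subgroup_axioms e])
  then show ?thesis
    using one_closed ij by (simp add: add_block_ring) (simp add: morita_ring_def)
qed

end

end


section \<open>Data for generalized matrix rings\<close>

context datum
begin

text \<open>The subgroup \<open>D i g M i j = M i j D j g\<close> of the entry \<open>M i j\<close>.  For \<open>i = j\<close> it is \<open>D i g\<close> (lemma
  \<open>part_diagonal\<close>), so that all four entries of the block can be treated alike.\<close>

abbreviation part where
  "part i j g \<equiv> left_part (M i j) (D i g)"

lemma D_ideal: "\<lbrakk>i \<in> {1..n}; g \<in> carrier G\<rbrakk> \<Longrightarrow> ideal (D i g) (M i i)"
  using partial_actions partial_action.ideals by metis

lemma D_carrier: "\<lbrakk>i \<in> {1..n}; g \<in> carrier G; d \<in> D i g\<rbrakk> \<Longrightarrow> d \<in> carrier (M i i)"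
  using D_ideal ideal.Icarr by metis

context
  fixes i j g
  assumes ij: "i \<in> {1..n}" "j \<in> {1..n}" and g: "g \<in> carrier G"
begin

lemma part_left: "part i j g = span_prod (M i j) (gm_mult M \<theta> i i j) (D i g) (carrier (M i j))"
  unfolding left_part_def using ij g by (intro span_prod_cong) (simp add: theta_lact D_carrier)

lemma part_right: "part i j g = span_prod (M i j) (gm_mult M \<theta> i j j) (carrier (M i j)) (D j g)"
  unfolding left_right [OF g ij] right_part_def
  using ij g by (intro span_prod_cong) (simp add: theta_ract D_carrier)

lemma part_subgroup: "subgroup (part i j g) (add_monoid (M i j))"
  unfolding part_left using ij g
  by (intro span_prod_subgroup entry_abelian_group gm_closed) (auto intro: D_carrier)

lemma part_carrier: "u \<in> part i j g \<Longrightarrow> u \<in> carrier (M i j)"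
  using subgroup.subset [OF part_subgroup] by auto

text \<open>Multiplication from the right preserves the form \<open>D i g M i j\<close>, and multiplication from the left
  preserves the form \<open>M i j D j g\<close>.  As both describe \<open>part i j g\<close>, these subgroups absorb products on
  either side.\<close>

lemma part_gm_right:
  assumes k: "k \<in> {1..n}" and u: "u \<in> part i j g" and y: "y \<in> carrier (M j k)"
  shows "gm_mult M \<theta> i j k u y \<in> part i k g"
proof (rule additive_map_span_prod [where f = "\<lambda>u. gm_mult M \<theta> i j k u y"])
  show "u \<in> span_prod (M i j) (gm_mult M \<theta> i i j) (D i g) (carrier (M i j))"
    using u part_left by simp
  fix d m assume d: "d \<in> D i g" and m: "m \<in> carrier (M i j)"
  then have "gm_mult M \<theta> i j k (gm_mult M \<theta> i i j d m) y = gm_mult M \<theta> i i k d (gm_mult M \<theta> i j k m y)"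
    using ij g k y by (intro theta_assoc D_carrier)
  also have "\<dots> \<in> span_prod (M i k) (gm_mult M \<theta> i i k) (D i g) (carrier (M i k))"
    using d m ij k y by (intro span_prod_memI gm_closed)
  also have "\<dots> = part i k g"
    by (rule datum.part_left [symmetric, OF datum_axioms ij(1) k g])
  finally show "gm_mult M \<theta> i j k (gm_mult M \<theta> i i j d m) y \<in> part i k g" .
  show "gm_mult M \<theta> i i j d m \<in> carrier (M i j)"
    using d m ij g by (intro gm_closed D_carrier)
qed (use ij g k y in \<open>auto simp: gm_closed gm_add_left entry_abelian_group
    datum.part_subgroup [OF datum_axioms] simp del: atLeastAtMost_iff\<close>)

lemma part_gm_left:
  assumes k: "k \<in> {1..n}" and u: "u \<in> part i j g" and x: "x \<in> carrier (M k i)"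
  shows "gm_mult M \<theta> k i j x u \<in> part k j g"
proof (rule additive_map_span_prod [where f = "gm_mult M \<theta> k i j x"])
  show "u \<in> span_prod (M i j) (gm_mult M \<theta> i j j) (carrier (M i j)) (D j g)"
    using u part_right by simp
  fix m d assume d: "d \<in> D j g" and m: "m \<in> carrier (M i j)"
  then have "gm_mult M \<theta> k i j x (gm_mult M \<theta> i j j m d) = gm_mult M \<theta> k j j (gm_mult M \<theta> k i j x m) d"
    using ij g k x by (intro theta_assoc [symmetric] D_carrier)
  also have "\<dots> \<in> span_prod (M k j) (gm_mult M \<theta> k j j) (carrier (M k j)) (D j g)"
    using d m ij k x by (intro span_prod_memI gm_closed)
  also have "\<dots> = part k j g"
    by (rule datum.part_right [symmetric, OF datum_axioms k ij(2) g])
  finally show "gm_mult M \<theta> k i j x (gm_mult M \<theta> i j j m d) \<in> part k j g" .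
  show "gm_mult M \<theta> i j j m d \<in> carrier (M i j)"
    using d m ij g by (intro gm_closed D_carrier)
qed (use ij g k x in \<open>auto simp: gm_closed gm_add_right entry_abelian_group
    datum.part_subgroup [OF datum_axioms] simp del: atLeastAtMost_iff\<close>)

lemma part_diagonal: "part i i g = D i g"
proof
  interpret D: ideal "D i g" "M i i" by (rule D_ideal [OF ij(1) g])
  show "part i i g \<subseteq> D i g"
  proof
    fix u assume u: "u \<in> part i i g"
    show "u \<in> D i g"
    proof (rule additive_map_span_prod [where f = "\<lambda>u. u"])
      show "u \<in> span_prod (M i i) (lact (M i i)) (D i g) (carrier (M i i))"
        using u by (simp add: left_part_def)
      fix d m assume dm: "d \<in> D i g" "m \<in> carrier (M i i)"
      then have "lact (M i i) d m = d \<otimes>\<^bsub>M i i\<^esub> m"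
        using ij theta_ring theta_lact D.Icarr by metis
      then show "lact (M i i) d m \<in> D i g" and "lact (M i i) d m \<in> carrier (M i i)"
        using dm by (auto intro: D.I_r_closed)
    qed (use D.a_subgroup in \<open>auto intro: D.is_abelian_group\<close>)
  qed
  show "D i g \<subseteq> part i i g"
  proof
    fix d assume d: "d \<in> D i g"
    then have "gm_mult M \<theta> i i i d \<one>\<^bsub>M i i\<^esub> = d"
      using ij by (simp add: gm_one_right D.Icarr del: atLeastAtMost_iff)
    then show "d \<in> part i i g"
      using d ij one_closed span_prod_memI [of d "D i g" "\<one>\<^bsub>M i i\<^esub>" "carrier (M i i)"]
      by (metis datum.part_left datum_axioms g)
  qed
qed

lemma gamma_closed: "u \<in> part i j (inv\<^bsub>G\<^esub> g) \<Longrightarrow> \<gamma> i j g u \<in> part i j g"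
  using gamma_bij [OF g ij] by (auto simp: bij_betw_def)

lemma gamma_zero: "\<gamma> i j g \<zero>\<^bsub>M i j\<^esub> = \<zero>\<^bsub>M i j\<^esub>"
proof -
  interpret B: abelian_group "M i j" by (rule entry_abelian_group [OF ij])
  have zero: "\<zero>\<^bsub>M i j\<^esub> \<in> part i j (inv\<^bsub>G\<^esub> g)"
    using subgroup.one_closed [OF datum.part_subgroup [OF datum_axioms ij]] g by simp
  show ?thesis
    using gamma_add [OF g ij zero zero] part_carrier [OF gamma_closed [OF zero]] by simp
qed

end

lemma part_one:
  assumes "i \<in> {1..n}" and "j \<in> {1..n}"
  shows "part i j \<one>\<^bsub>G\<^esub> = carrier (M i j)"
proof
  show "carrier (M i j) \<subseteq> part i j \<one>\<^bsub>G\<^esub>"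
  proof
    fix m assume "m \<in> carrier (M i j)"
    then show "m \<in> part i j \<one>\<^bsub>G\<^esub>"
      unfolding part_left [OF assms G.one_closed]
      using assms one_closed [of i] partial_action.D_one [OF partial_actions [OF assms(1)]]
        gm_one_left [OF assms, of m] span_prod_memI [of "\<one>\<^bsub>M i i\<^esub>" "D i \<one>\<^bsub>G\<^esub>" m "carrier (M i j)"]
      by metis
  qed
qed (use assms in \<open>auto intro: part_carrier\<close>)

lemma gamma_inverse:
  assumes ij: "i \<in> {1..n}" "j \<in> {1..n}" and g: "g \<in> carrier G" and u: "u \<in> part i j g"
  shows "\<gamma> i j g (\<gamma> i j (inv\<^bsub>G\<^esub> g) u) = u"
proof -
  have "\<gamma> i j g (\<gamma> i j (inv\<^bsub>G\<^esub> g) u) = \<gamma> i j (g \<otimes>\<^bsub>G\<^esub> inv\<^bsub>G\<^esub> g) u"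
    using ij g u gamma_closed [of i j "inv\<^bsub>G\<^esub> g" u] by (intro gamma_mult) simp_all
  then show ?thesis
    using ij g u by (simp add: gamma_one part_carrier)
qed


section \<open>The partial action on the Morita ring\<close>

definition block_ideal where
  "block_ideal i j g = part i i g \<times> part i j g \<times> part j i g \<times> part j j g"

definition block_action where
  "block_action i j g =
    map_prod (\<gamma> i i g) (map_prod (\<gamma> i j g) (map_prod (\<gamma> j i g) (\<gamma> j j g)))"

context
  fixes i j
  assumes ij: "i \<in> {1..n}" "j \<in> {1..n}"
begin

lemma ideal_block_ideal:
  assumes g: "g \<in> carrier G"
  shows "ideal (block_ideal i j g) (block_ring i j)"
proof (rule idealI)
  show R: "ring (block_ring i j)" by (rule ring_block_ring [OF ij])
  interpret R: ring "block_ring i j" by fact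
  interpret A: abelian_group "M i i" by (rule entry_abelian_group [OF ij(1) ij(1)])
  interpret B: abelian_group "M i j" by (rule entry_abelian_group [OF ij])
  interpret C: abelian_group "M j i" by (rule entry_abelian_group [OF ij(2) ij(1)])
  interpret E: abelian_group "M j j" by (rule entry_abelian_group [OF ij(2) ij(2)])
  interpret SA: subgroup "part i i g" "add_monoid (M i i)" by (rule part_subgroup [OF ij(1) ij(1) g])
  interpret SB: subgroup "part i j g" "add_monoid (M i j)" by (rule part_subgroup [OF ij g])
  interpret SC: subgroup "part j i g" "add_monoid (M j i)" by (rule part_subgroup [OF ij(2) ij(1) g])
  interpret SE: subgroup "part j j g" "add_monoid (M j j)" by (rule part_subgroup [OF ij(2) ij(2) g])
  note parts = part_gm_left part_gm_right part_carrier [OF _ _ g] ij g SA.m_closed [simplified] SB.m_closed [simplified]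
    SC.m_closed [simplified] SE.m_closed [simplified]
  have inv: "\<ominus>\<^bsub>block_ring i j\<^esub> (a, b, c, d) = (\<ominus>\<^bsub>M i i\<^esub> a, \<ominus>\<^bsub>M i j\<^esub> b, \<ominus>\<^bsub>M j i\<^esub> c, \<ominus>\<^bsub>M j j\<^esub> d)"
    if "a \<in> carrier (M i i)" "b \<in> carrier (M i j)" "c \<in> carrier (M j i)" "d \<in> carrier (M j j)" for a b c d
    by (rule R.minus_equality)
      (use that ij in \<open>simp_all add: carrier_block_ring add_block_ring A.l_neg B.l_neg C.l_neg E.l_neg\<close>,
       simp add: morita_ring_def)
  show "subgroup (block_ideal i j g) (add_monoid (block_ring i j))"
  proof (rule R.add.subgroupI)
    show "block_ideal i j g \<subseteq> carrier (block_ring i j)"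
      using ij g by (auto simp: block_ideal_def carrier_block_ring intro: part_carrier)
    show "block_ideal i j g \<noteq> {}"
      using SA.one_closed SB.one_closed SC.one_closed SE.one_closed by (auto simp: block_ideal_def)
    fix x y assume "x \<in> block_ideal i j g" "y \<in> block_ideal i j g"
    then show "x \<oplus>\<^bsub>block_ring i j\<^esub> y \<in> block_ideal i j g"
      by (auto simp: block_ideal_def add_block_ring [OF ij] parts)
  next
    fix x assume "x \<in> block_ideal i j g"
    then show "\<ominus>\<^bsub>block_ring i j\<^esub> x \<in> block_ideal i j g"
      using SA.m_inv_closed SB.m_inv_closed SC.m_inv_closed SE.m_inv_closed ij g
      by (auto simp: block_ideal_def inv part_carrier simp flip: a_inv_def)
  qed
  fix x r assume x: "x \<in> block_ideal i j g" and r: "r \<in> carrier (block_ring i j)"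
  show "r \<otimes>\<^bsub>block_ring i j\<^esub> x \<in> block_ideal i j g"
    using x r by (cases x rule: prod_cases4; cases r rule: prod_cases4;
        simp only: block_ideal_def carrier_block_ring [OF ij] mem_Times_iff fst_conv snd_conv
          mult_block_ring parts)
  show "x \<otimes>\<^bsub>block_ring i j\<^esub> r \<in> block_ideal i j g"
    using x r by (cases x rule: prod_cases4; cases r rule: prod_cases4;
        simp only: block_ideal_def carrier_block_ring [OF ij] mem_Times_iff fst_conv snd_conv
          mult_block_ring parts)
qed

lemma block_action_iso:
  assumes g: "g \<in> carrier G"
  shows "ideal_iso (block_ring i j) (block_ideal i j (inv\<^bsub>G\<^esub> g)) (block_ideal i j g)
    (block_action i j g)"
  unfolding ideal_iso_def
proof (intro conjI ballI)
  show "bij_betw (block_action i j g) (block_ideal i j (inv\<^bsub>G\<^esub> g)) (block_ideal i j g)"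
    unfolding block_action_def block_ideal_def
    by (intro bij_betw_map_prod gamma_bij g ij)
  have g': "inv\<^bsub>G\<^esub> g \<in> carrier G" using g by simp
  fix x y assume x: "x \<in> block_ideal i j (inv\<^bsub>G\<^esub> g)" and y: "y \<in> block_ideal i j (inv\<^bsub>G\<^esub> g)"
  note gm = ij g g' block_ideal_def block_action_def mem_Times_iff fst_conv snd_conv map_prod_simp
    gamma_closed part_carrier [OF _ _ g] part_carrier [OF _ _ g'] prod.inject
  show "block_action i j g (x \<oplus>\<^bsub>block_ring i j\<^esub> y) =
      block_action i j g x \<oplus>\<^bsub>block_ring i j\<^esub> block_action i j g y"
    using x y by (cases x rule: prod_cases4; cases y rule: prod_cases4;
        simp only: gm add_block_ring gamma_add)
  show "block_action i j g (x \<otimes>\<^bsub>block_ring i j\<^esub> y) =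
      block_action i j g x \<otimes>\<^bsub>block_ring i j\<^esub> block_action i j g y"
    using x y by (cases x rule: prod_cases4; cases y rule: prod_cases4;
        simp only: gm mult_block_ring gamma_product gamma_add part_gm_right [OF _ _ g'])
qed

lemma block_partial_action:
  "partial_action G (block_ring i j) (block_ideal i j) (block_action i j)"
proof (intro partial_action.intro partial_action_axioms.intro ring_block_ring ij G.group_axioms)
  fix g assume g: "g \<in> carrier G"
  show "ideal (block_ideal i j g) (block_ring i j)"
    by (rule ideal_block_ideal [OF g])
  show "ideal_iso (block_ring i j) (block_ideal i j (inv\<^bsub>G\<^esub> g)) (block_ideal i j g)
      (block_action i j g)"
    by (rule block_action_iso [OF g])
next
  show "block_ideal i j \<one>\<^bsub>G\<^esub> = carrier (block_ring i j)"
    using ij by (simp add: block_ideal_def carrier_block_ring part_one)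
  show "block_action i j \<one>\<^bsub>G\<^esub> x = x" if "x \<in> carrier (block_ring i j)" for x
    using that ij by (auto simp: block_action_def carrier_block_ring gamma_one)
next
  fix g h assume g: "g \<in> carrier G" and h: "h \<in> carrier G"
  have domain: "\<gamma> p q (inv\<^bsub>G\<^esub> h) b \<in> part p q (inv\<^bsub>G\<^esub> (g \<otimes>\<^bsub>G\<^esub> h))"
    if "p \<in> {1..n}" "q \<in> {1..n}" "b \<in> part p q h" "b \<in> part p q (inv\<^bsub>G\<^esub> g)" for p q b
    by (rule gamma_domains [OF g h])
      (use that gamma_closed [of p q "inv\<^bsub>G\<^esub> h" b] g h in \<open>auto simp: gamma_inverse\<close>)
  show "block_action i j (inv\<^bsub>G\<^esub> h) ` (block_ideal i j h \<inter> block_ideal i j (inv\<^bsub>G\<^esub> g))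
      \<subseteq> block_ideal i j (inv\<^bsub>G\<^esub> (g \<otimes>\<^bsub>G\<^esub> h))"
    using ij by (auto simp: block_ideal_def block_action_def domain)
  fix a assume "a \<in> block_ideal i j (inv\<^bsub>G\<^esub> h)"
    "block_action i j h a \<in> block_ideal i j h \<inter> block_ideal i j (inv\<^bsub>G\<^esub> g)"
  then show "block_action i j g (block_action i j h a) = block_action i j (g \<otimes>\<^bsub>G\<^esub> h) a"
    using ij g h by (auto simp: block_ideal_def block_action_def gamma_mult)
qed

text \<open>Both sides are ideals of the block, and the unit \<open>e\<close> of \<open>R\<^sub>i\<close> is full by \<open>corner_unit_full\<close>.
  Therefore it is enough to compare the corners at \<open>e\<close>, where the inclusion is the assumption
  \<open>regular\<close>.\<close>

lemma block_ideal_Int_subset_prod: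
  assumes surj: "span_prod (M j j) (gm_mult M \<theta> j i j) (carrier (M j i)) (carrier (M i j)) = carrier (M j j)"
    and g: "g \<in> carrier G" and h: "h \<in> carrier G"
    and regular: "D i g \<inter> D i h \<subseteq> D i g \<cdot>\<^bsub>M i i\<^esub> D i h"
  shows "block_ideal i j g \<inter> block_ideal i j h \<subseteq>
    block_ideal i j g \<cdot>\<^bsub>block_ring i j\<^esub> block_ideal i j h"
proof -
  let ?R = "block_ring i j"
  let ?\<iota> = "\<lambda>a. (a, \<zero>\<^bsub>M i j\<^esub>, \<zero>\<^bsub>M j i\<^esub>, \<zero>\<^bsub>M j j\<^esub>)"
  interpret R: ring ?R by (rule ring_block_ring [OF ij])
  interpret A: abelian_group "M i i" by (rule entry_abelian_group [OF ij(1) ij(1)])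
  interpret B: abelian_group "M i j" by (rule entry_abelian_group [OF ij])
  interpret C: abelian_group "M j i" by (rule entry_abelian_group [OF ij(2) ij(1)])
  interpret E: abelian_group "M j j" by (rule entry_abelian_group [OF ij(2) ij(2)])
  note calc = ij one_closed A.zero_closed B.zero_closed C.zero_closed E.zero_closed gm_closed
    gm_one_left gm_one_right gm_zero_left gm_zero_right
    A.r_zero B.r_zero C.r_zero E.r_zero A.l_zero B.l_zero C.l_zero E.l_zero
  have zero: "\<zero>\<^bsub>M p q\<^esub> \<in> part p q f" if "p \<in> {1..n}" "q \<in> {1..n}" "f \<in> carrier G" for p q f
    using subgroup.one_closed [OF part_subgroup [OF that]] by simp
  have embed: "?\<iota> a \<in> block_ideal i j f" if "a \<in> D i f" "f \<in> carrier G" for a f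
    using that zero [of j j f] zero [of i j f] zero [of j i f] ij
    by (simp add: block_ideal_def part_diagonal [OF ij(1) ij(1)])
  have embed_prod: "?\<iota> a \<in> block_ideal i j g \<cdot>\<^bsub>?R\<^esub> block_ideal i j h"
    if "a \<in> D i g \<cdot>\<^bsub>M i i\<^esub> D i h" for a
    using that
  proof induction
    case (prod a b)
    then have ab: "a \<in> carrier (M i i)" "b \<in> carrier (M i i)"
      using D_carrier ij g h by blast+
    have "?\<iota> (a \<otimes>\<^bsub>M i i\<^esub> b) = ?\<iota> a \<otimes>\<^bsub>?R\<^esub> ?\<iota> b"
      by (simp only: mult_block_ring calc ab theta_ring [symmetric])
    then show ?case
      using prod embed g h by (metis ideal_prod.prod)
  next
    case (sum a b)
    then show ?case
      using ideal_prod.sum [of "?\<iota> a" ?R _ _ "?\<iota> b"] ij by (simp add: add_block_ring)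
  qed
  show ?thesis
  proof (rule R.ideal_subset_of_full_corner [where e = "?\<iota> \<one>\<^bsub>M i i\<^esub>"])
    show "?\<iota> \<one>\<^bsub>M i i\<^esub> \<in> carrier ?R"
      using ij by (simp add: carrier_block_ring one_closed)
    show "\<one>\<^bsub>?R\<^esub> \<in> S" if "ideal S ?R" "?\<iota> \<one>\<^bsub>M i i\<^esub> \<in> S" for S
      by (rule corner_unit_full [OF ij surj that])
    show "ideal (block_ideal i j g \<inter> block_ideal i j h) ?R"
      by (intro R.i_intersect ideal_block_ideal g h)
    show "ideal (block_ideal i j g \<cdot>\<^bsub>?R\<^esub> block_ideal i j h) ?R"
      by (intro R.ideal_prod_is_ideal ideal_block_ideal g h)
    fix x assume "x \<in> block_ideal i j g \<inter> block_ideal i j h"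
    then obtain a b c d where x: "x = (a, b, c, d)" and a: "a \<in> part i i g" "a \<in> part i i h"
      and bcd: "b \<in> part i j g" "c \<in> part j i g" "d \<in> part j j g"
      by (auto simp: block_ideal_def)
    have car: "a \<in> carrier (M i i)" "b \<in> carrier (M i j)" "c \<in> carrier (M j i)" "d \<in> carrier (M j j)"
      using a bcd ij g by (auto intro: part_carrier)
    have "?\<iota> \<one>\<^bsub>M i i\<^esub> \<otimes>\<^bsub>?R\<^esub> x \<otimes>\<^bsub>?R\<^esub> ?\<iota> \<one>\<^bsub>M i i\<^esub> = ?\<iota> a"
      by (simp only: x mult_block_ring calc car)
    also have "\<dots> \<in> block_ideal i j g \<cdot>\<^bsub>?R\<^esub> block_ideal i j h"
      using a regular ij g h by (intro embed_prod) (auto simp: part_diagonal)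
    finally show "?\<iota> \<one>\<^bsub>M i i\<^esub> \<otimes>\<^bsub>?R\<^esub> x \<otimes>\<^bsub>?R\<^esub> ?\<iota> \<one>\<^bsub>M i i\<^esub> \<in>
      block_ideal i j g \<cdot>\<^bsub>?R\<^esub> block_ideal i j h" .
  qed
qed

text \<open>The inclusion of \<open>D j g\<close> in the span: \<open>1 \<in> M j i M i j\<close> gives
  \<open>d = 1 d \<in> M j i (M i j D j g) = M j i (D i g M i j)\<close> for \<open>d\<close> in \<open>D j g\<close>.\<close>

lemma span_entry_part:
  assumes surj: "span_prod (M j j) (gm_mult M \<theta> j i j) (carrier (M j i)) (carrier (M i j)) = carrier (M j j)"
    and g: "g \<in> carrier G"
  shows "span_prod (M j j) (gm_mult M \<theta> j i j) (carrier (M j i)) (part i j g) = D j g"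
proof
  interpret E: abelian_group "M j j" by (rule entry_abelian_group [OF ij(2) ij(2)])
  let ?S = "span_prod (M j j) (gm_mult M \<theta> j i j) (carrier (M j i)) (part i j g)"
  have closed: "gm_mult M \<theta> j i j x u \<in> D j g" if "x \<in> carrier (M j i)" "u \<in> part i j g" for x u
    using part_gm_left [OF ij g ij(2) that(2,1)] part_diagonal [OF ij(2) ij(2) g] by simp
  show "?S \<subseteq> D j g"
    unfolding span_prod_def
    using closed part_subgroup [OF ij(2) ij(2) g] part_diagonal [OF ij(2) ij(2) g]
    by (intro E.add.generate_subgroup_incl) auto
  show "D j g \<subseteq> ?S"
  proof
    fix d assume d: "d \<in> D j g"
    then have dcar: "d \<in> carrier (M j j)" using D_carrier ij g by blast
    have "gm_mult M \<theta> j j j \<one>\<^bsub>M j j\<^esub> d \<in> ?S"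
    proof (rule additive_map_span_prod [where f = "\<lambda>x. gm_mult M \<theta> j j j x d"])
      show "\<one>\<^bsub>M j j\<^esub> \<in> span_prod (M j j) (gm_mult M \<theta> j i j) (carrier (M j i)) (carrier (M i j))"
        using surj one_closed ij by simp
      show "subgroup ?S (add_monoid (M j j))"
        using closed D_carrier ij g by (intro span_prod_subgroup) (blast intro: E.abelian_group_axioms)+
      fix x y assume x: "x \<in> carrier (M j i)" and y: "y \<in> carrier (M i j)"
      then have "gm_mult M \<theta> j j j (gm_mult M \<theta> j i j x y) d = gm_mult M \<theta> j i j x (gm_mult M \<theta> i j j y d)"
        using ij dcar by (intro theta_assoc)
      also have "\<dots> \<in> ?S"
        unfolding part_right [OF ij g] using x y d by (intro span_prod_memI)
      finally show "gm_mult M \<theta> j j j (gm_mult M \<theta> j i j x y) d \<in> ?S" .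
      show "gm_mult M \<theta> j i j x y \<in> carrier (M j j)"
        using x y ij by (intro gm_closed)
    qed (use ij dcar in \<open>auto intro: gm_closed gm_add_left E.abelian_group_axioms\<close>)
    then show "d \<in> ?S"
      using ij dcar by (simp add: gm_one_left)
  qed
qed

end

end


section \<open>Independence of scalar multiplications\<close>

text \<open>Morita equivalence is stated for algebras, whereas the generalized matrix ring carries
  rings.  All notions involved, apart from linearity, see only the underlying ring.\<close>

lemma with_smult_simps [simp]:
  "carrier (with_smult A s) = carrier A"
  "mult (with_smult A s) = mult A"
  "one (with_smult A s) = one A"
  "zero (with_smult A s) = zero A"
  "add (with_smult A s) = add A"
  by (simp_all add: with_smult_def)

lemma tensor_product_with_smult [simp]:
  "tensor_product (with_smult S s) M N = tensor_product S M N"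
  by (simp add: tensor_product_def tensor_relations_def)

lemma pure_tensor_with_smult [simp]:
  "pure_tensor (with_smult S s) M N = pure_tensor S M N"
  by (intro ext) (simp add: pure_tensor_def tensor_relations_def)

lemma morita_ring_with_smult [simp]:
  "morita_ring (with_smult A s) (with_smult A' s') M M' \<tau> \<tau>' = morita_ring A A' M M' \<tau> \<tau>'"
  by (simp add: morita_ring_def)

text \<open>The records \<open>B\<close> and \<open>B'\<close> may have different extension fields, hence different types, so that
  equality of the additive monoids cannot be used to rewrite.\<close>

lemma generate_add_monoid_cong:
  assumes "u \<in> generate (add_monoid B) S"
    and "add B = add B'" "zero B = zero B'" "carrier B = carrier B'"
  shows "u \<in> generate (add_monoid B') S"
  using assms(1)
proof (induction rule: generate.induct)
  case one
  show ?case
    using generate.one [of "add_monoid B'" S] assms by simp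
next
  case (incl h)
  then show ?case by (rule generate.incl)
next
  case (inv h)
  have "inv\<^bsub>add_monoid B\<^esub> h = inv\<^bsub>add_monoid B'\<^esub> h"
    using assms by (simp add: m_inv_def)
  then show ?case
    using generate.inv [OF inv, of "add_monoid B'"] by simp
next
  case (eng h h')
  then show ?case
    using generate.eng [of h "add_monoid B'" S h'] assms by simp
qed

lemma span_prod_with_smult [simp]: "span_prod (with_smult A s) p X Y = span_prod A p X Y"
  unfolding span_prod_def
  by (intro subset_antisym subsetI; erule generate_add_monoid_cong; simp)

lemma ideal_prod_cong:
  assumes "x \<in> ideal_prod B I J" and "add B = add B'" and "mult B = mult B'"
  shows "x \<in> ideal_prod B' I J"
  using assms(1)
proof (induction rule: ideal_prod.induct)
  case (prod a b)
  then show ?case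
    using ideal_prod.prod [of a I b J B'] assms by simp
next
  case (sum a b)
  then show ?case
    using ideal_prod.sum [of a B' I J b] assms by simp
qed

lemma ideal_prod_with_smult [simp]: "ideal_prod (with_smult A s) I J = ideal_prod A I J"
  by (intro subset_antisym subsetI; erule ideal_prod_cong; simp)

lemma regular_action_with_smult [simp]:
  "regular_action G (with_smult A s) D \<longleftrightarrow> regular_action G A D"
proof -
  have "ideal_prod_list (with_smult A s) Is = ideal_prod_list A Is" for Is
    by (induction Is rule: ideal_prod_list.induct) simp_all
  then show ?thesis by (simp add: regular_action_def)
qed

lemma unital_bimodule_with_smult:
  assumes "unital_bimodule R S M" and "ring (with_smult R s)" and "ring (with_smult S s')"
  shows "unital_bimodule (with_smult R s) (with_smult S s') M"
  using assms by (simp add: unital_bimodule_def unital_bimodule_axioms_def)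


section \<open>The Morita context of two diagonal entries\<close>

text \<open>The target of the pairing is \<open>R\<^sub>i\<close>, acting on itself by multiplication.  The actions stored in
  the record \<open>M i i\<close> agree with this multiplication, since both are given by \<open>\<theta> i i i\<close>.\<close>

lemma (in generalized_matrix_ring) block_tensor_hom:
  assumes ij: "i \<in> {1..n}" "j \<in> {1..n}"
  shows "tensor_bimodule_hom (with_smult (M i i) s) (with_smult (M j j) s') (with_smult (M i i) s)
    (M i j) (M j i) (ring_bimod (with_smult (M i i) s)) (\<theta> i j i)"
proof -
  have act: "lact (M i i) r (gm_mult M \<theta> i j i m x) = r \<otimes>\<^bsub>M i i\<^esub> gm_mult M \<theta> i j i m x"
      "ract (M i i) (gm_mult M \<theta> i j i m x) r = gm_mult M \<theta> i j i m x \<otimes>\<^bsub>M i i\<^esub> r"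
    if "r \<in> carrier (M i i)" "m \<in> carrier (M i j)" "x \<in> carrier (M j i)" for r m x
    using that ij theta_lact [of i i r] theta_ract [of i i _ r] theta_ring [of i] gm_closed [of i j i m x]
    by (metis, metis)
  show ?thesis
    using theta_hom [OF ij ij(1)] act
    by (simp add: tensor_bimodule_hom_def hom_def ring_bimod_def gm_mult_def)
qed

lemma (in generalized_matrix_ring) block_morita_context:
  assumes ij: "i \<in> {1..n}" "j \<in> {1..n}"
    and rings: "ring (with_smult (M i i) s)" "ring (with_smult (M j j) s')"
  shows "morita_context (with_smult (M i i) s) (with_smult (M j j) s') (M i j) (M j i)
    (\<theta> i j i) (\<theta> j i j)"
proof (intro morita_context.intro morita_context_axioms.intro)
  show "unital_bimodule (with_smult (M i i) s) (with_smult (M j j) s') (M i j)"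
    "unital_bimodule (with_smult (M j j) s') (with_smult (M i i) s) (M j i)"
    by (intro unital_bimodule_with_smult entry_bimodule ij rings)+
next
  show "lact (M i j) (\<theta> i j i (pure_tensor (with_smult (M j j) s') (M i j) (M j i) x y)) z =
      ract (M i j) x (\<theta> j i j (pure_tensor (with_smult (M i i) s) (M j i) (M i j) y z))"
    if "x \<in> carrier (M i j)" "y \<in> carrier (M j i)" "z \<in> carrier (M i j)" for x y z
    using theta_assoc [OF ij ij that] theta_lact [OF ij gm_closed [OF ij ij(1) that(1,2)] that(3)]
      theta_ract [OF ij that(1) gm_closed [OF ij(2) ij that(2,3)]]
    by (simp add: gm_mult_def)
next
  show "lact (M j i) (\<theta> j i j (pure_tensor (with_smult (M i i) s) (M j i) (M i j) y x)) w =
      ract (M j i) y (\<theta> i j i (pure_tensor (with_smult (M j j) s') (M i j) (M j i) x w))"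
    if "y \<in> carrier (M j i)" "x \<in> carrier (M i j)" "w \<in> carrier (M j i)" for y x w
    using theta_assoc [OF ij(2,1) ij(2,1) that]
      theta_lact [OF ij(2,1) gm_closed [OF ij(2,1,2) that(1,2)] that(3)]
      theta_ract [OF ij(2,1) that(1) gm_closed [OF ij ij(1) that(2,3)]]
    by (simp add: gm_mult_def)
qed (intro block_tensor_hom ij)+

lemma (in generalized_matrix_ring) theta_surj:
  assumes ij: "i \<in> {1..n}" "j \<in> {1..n}"
    and surj: "span_prod (M i i) (gm_mult M \<theta> i j i) (carrier (M i j)) (carrier (M j i)) = carrier (M i i)"
  shows "\<theta> i j i ` carrier (tensor_product (M j j) (M i j) (M j i)) = carrier (M i i)"
proof
  have hom: "\<theta> i j i \<in> hom (tensor_product (M j j) (M i j) (M j i)) (add_monoid (M i i))"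
    using theta_hom [OF ij ij(1)] by (simp add: tensor_bimodule_hom_def)
  then show "\<theta> i j i ` carrier (tensor_product (M j j) (M i j) (M j i)) \<subseteq> carrier (M i i)"
    by (auto simp: hom_def)
  show "carrier (M i i) \<subseteq> \<theta> i j i ` carrier (tensor_product (M j j) (M i j) (M j i))"
    using hom_tensor_image_span [OF entry_bimodule [OF ij] entry_bimodule [OF ij(2,1)]
        entry_abelian_group [OF ij(1) ij(1)] hom] surj
    by (simp flip: gm_mult_def)
qed

theorem proposition4p15:
  fixes G :: "('g, 'x) monoid_scheme" and K :: "('k, 'y) ring_scheme" and n i j :: nat
    and M :: "nat \<Rightarrow> nat \<Rightarrow> ('a, 'a, 'a) bimod"
    and \<theta> :: "nat \<Rightarrow> nat \<Rightarrow> nat \<Rightarrow> (('a \<times> 'a) \<Rightarrow>\<^sub>0 int) set \<Rightarrow> 'a"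
    and D :: "nat \<Rightarrow> 'g \<Rightarrow> 'a set"
    and \<alpha> :: "nat \<Rightarrow> 'g \<Rightarrow> 'a \<Rightarrow> 'a"
    and \<gamma> :: "nat \<Rightarrow> nat \<Rightarrow> 'g \<Rightarrow> 'a \<Rightarrow> 'a"
    and s :: "nat \<Rightarrow> 'k \<Rightarrow> 'a \<Rightarrow> 'a"
  assumes "group G" and "cring K" and "n \<ge> 1"
    and "generalized_matrix_ring n M \<theta>"
    and "datum G n M \<theta> D \<alpha> \<gamma>"
    and "i \<in> {1..n}" and "j \<in> {1..n}"
    and "algebra_partial_action K G (with_smult (M i i) (s i)) (D i) (\<alpha> i)"
    and "algebra_partial_action K G (with_smult (M j j) (s j)) (D j) (\<alpha> j)"
    and "span_prod (M i i) (gm_mult M \<theta> i j i) (carrier (M i j)) (carrier (M j i)) = carrier (M i i)"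
    and "span_prod (M j j) (gm_mult M \<theta> j i j) (carrier (M j i)) (carrier (M i j)) = carrier (M j j)"
    and "regular_action G (M i i) (D i)"
    and "regular_action G (M j j) (D j)"
  shows "morita_equivalent TYPE('a) TYPE('a) K G
           (with_smult (M i i) (s i)) (D i) (\<alpha> i)
           (with_smult (M j j) (s j)) (D j) (\<alpha> j)"
proof -
  let ?A = "with_smult (M i i) (s i)" and ?B = "with_smult (M j j) (s j)"
  interpret datum G n M \<theta> D \<alpha> \<gamma> by fact
  note ij = assms(6,7) and surj = assms(10,11)
  let ?R = "block_ring i j"
  have rings: "ring ?A" "ring ?B"
    using assms(8,9) by (auto simp: algebra_partial_action_def k_algebra_def)
  have regular: "D i g \<inter> D i h \<subseteq> D i g \<cdot>\<^bsub>M i i\<^esub> D i h" if "g \<in> carrier G" "h \<in> carrier G" for g h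
    using assms(12) [unfolded regular_action_def, rule_format, of "[g, h]"] that by simp
  have product: "product_partial_action G ?R (block_ideal i j) (block_action i j)"
    by (intro partial_action_imp_product_partial_action block_partial_action ij
        block_ideal_Int_subset_prod surj(2) regular)
  have zero: "\<zero>\<^bsub>M p q\<^esub> \<in> part p q g" if "p \<in> {1..n}" "q \<in> {1..n}" "g \<in> carrier G" for p q g
    using subgroup.one_closed [OF part_subgroup [OF that]] by simp
  have restrict_i: "restricts_to G ?A (\<lambda>a. (a, \<zero>\<^bsub>M i j\<^esub>, \<zero>\<^bsub>M j i\<^esub>, \<zero>\<^bsub>?B\<^esub>))
      (block_ideal i j) (block_action i j) (D i) (\<alpha> i)"
    unfolding restricts_to_def
  proof (intro ballI conjI)
    fix g assume g: "g \<in> carrier G"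
    show "{a \<in> carrier ?A. (a, \<zero>\<^bsub>M i j\<^esub>, \<zero>\<^bsub>M j i\<^esub>, \<zero>\<^bsub>?B\<^esub>) \<in> block_ideal i j g} = D i g"
      using ij g zero [of i j g] zero [of j i g] zero [of j j g] part_diagonal [OF ij(1) ij(1) g]
        D_carrier [OF ij(1) g]
      by (auto simp: block_ideal_def)
    show "block_action i j g (a, \<zero>\<^bsub>M i j\<^esub>, \<zero>\<^bsub>M j i\<^esub>, \<zero>\<^bsub>?B\<^esub>) = (\<alpha> i g a, \<zero>\<^bsub>M i j\<^esub>, \<zero>\<^bsub>M j i\<^esub>, \<zero>\<^bsub>?B\<^esub>)"
      if "a \<in> D i (inv\<^bsub>G\<^esub> g)" for a
      using ij g that by (simp add: block_action_def gamma_diagonal gamma_zero)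
  qed
  have restrict_j: "restricts_to G ?B (\<lambda>a'. (\<zero>\<^bsub>?A\<^esub>, \<zero>\<^bsub>M i j\<^esub>, \<zero>\<^bsub>M j i\<^esub>, a'))
      (block_ideal i j) (block_action i j) (D j) (\<alpha> j)"
    unfolding restricts_to_def
  proof (intro ballI conjI)
    fix g assume g: "g \<in> carrier G"
    show "{a' \<in> carrier ?B. (\<zero>\<^bsub>?A\<^esub>, \<zero>\<^bsub>M i j\<^esub>, \<zero>\<^bsub>M j i\<^esub>, a') \<in> block_ideal i j g} = D j g"
      using ij g zero [of i j g] zero [of j i g] zero [of i i g] part_diagonal [OF ij(2) ij(2) g]
        D_carrier [OF ij(2) g]
      by (auto simp: block_ideal_def)
    show "block_action i j g (\<zero>\<^bsub>?A\<^esub>, \<zero>\<^bsub>M i j\<^esub>, \<zero>\<^bsub>M j i\<^esub>, a') = (\<zero>\<^bsub>?A\<^esub>, \<zero>\<^bsub>M i j\<^esub>, \<zero>\<^bsub>M j i\<^esub>, \<alpha> j g a')"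
      if "a' \<in> D j (inv\<^bsub>G\<^esub> g)" for a'
      using ij g that by (simp add: block_action_def gamma_diagonal gamma_zero)
  qed
  have "span_prod ?B (\<lambda>m' m. \<theta> j i j (pure_tensor ?A (M j i) (M i j) m' m)) (carrier (M j i))
      (part i j g) = D j g" if "g \<in> carrier G" for g
    using span_entry_part [OF ij surj(2) that] by (simp flip: gm_mult_def)
  then show ?thesis
    unfolding morita_equivalent_def
    using assms(8,9,12,13) block_morita_context [OF ij rings] theta_surj [OF ij surj(1)]
      theta_surj [OF ij(2,1) surj(2)] product restrict_i restrict_j
    by (intro conjI exI [of _ "M i j"] exI [of _ "M j i"] exI [of _ "\<theta> i j i"] exI [of _ "\<theta> j i j"]
        exI [of _ "block_ideal i j"] exI [of _ "block_action i j"] ballI)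
      (simp_all only: regular_action_with_smult tensor_product_with_smult morita_ring_with_smult
        with_smult_simps)
qed

end
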